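(* Let $P(\tau,i\boldsymbol{\xi})\in\mathbb{C}[\tau,\boldsymbol{\xi}]=\mathbb{C}[\boldsymbol{\xi}][\tau]$ (with $\boldsymbol{\xi}=(\xi_1,\dots,\xi_n)$), and suppose that for each $\boldsymbol{\xi}\in\mathbb{Z}^n$, $$P(\tau,i\boldsymbol{\xi})=c_{\boldsymbol{\xi}}\cdot\prod_{j=1}^{m_{\boldsymbol{\xi}}}(\tau-\lambda_{j,\boldsymbol{\xi}}),$$ with $m_{\boldsymbol{\xi}}\in\mathbb{N}_0=\{0,1,2,\dots\}$, $c_{\boldsymbol{\xi}}\in\mathbb{C}\setminus\{0\}$ and $\lambda_{1,\boldsymbol{\xi}},\dots,\lambda_{m_{\boldsymbol{\xi}},\boldsymbol{\xi}}\in\mathbb{C}$ (the roots $\lambda_{j,\boldsymbol{\xi}}$ being arbitrarily arranged). For $\boldsymbol{\xi}\in\mathbb{Z}^n$ let $$d_{\boldsymbol{\xi}}:=\begin{cases}1 & \text{if } \operatorname{Re}(\lambda_{j,\boldsymbol{\xi}})=0 \text{ for all } j=1,\dots,m_{\boldsymbol{\xi}},\\ \displaystyle\min_{j:\,\operatorname{Re}(\lambda_{j,\boldsymbol{\xi}})\neq 0}|\operatorname{Re}(\lambda_{j,\boldsymbol{\xi}})| & \text{otherwise.}\end{cases}$$ If (1) $(c_{\boldsymbol{\xi}}^{-1})_{\boldsymbol{\xi}\in\mathbb{Z}^n}\in s'(\mathbb{Z}^n)$, and (2) $(d_{\boldsymbol{\xi}}^{-1})_{\boldsymbol{\xi}\in\mathbb{Z}^n}\in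 s'(\mathbb{Z}^n)$, then the map $P\left(\frac{d}{dt},i\boldsymbol{\xi}\right):Y\to Y$ is surjective.
   Context: $\|\boldsymbol{\xi}\|_1=|\xi_1|+\cdots+|\xi_n|$ is the $1$-norm on $\mathbb{R}^n$. $s'(\mathbb{Z}^n)$ denotes the space of complex sequences $(a_{\boldsymbol{\xi}})_{\boldsymbol{\xi}\in\mathbb{Z}^n}$ of at most polynomial growth, i.e. such that there is $k\in\mathbb{N}$ with $|a_{\boldsymbol{\xi}}|\le k(1+\|\boldsymbol{\xi}\|_1)^k$ for all $\boldsymbol{\xi}\in\mathbb{Z}^n$. $\mathcal{S}(\mathbb{R})$ is the Schwartz space and $\mathcal{S}'(\mathbb{R})$ the space of tempered distributions on $\mathbb{R}$; $\langle\varphi,T\rangle$ is the (bilinear) duality pairing of a test function $\varphi$ and a distribution $T$. The space $Y$ is $$Y=\{(T_{\boldsymbol{\xi}})_{\boldsymbol{\xi}\in\mathbb{Z}^n}\in\mathcal{S}'(\mathbb{R})^{\mathbb{Z}^n}:\ \forall\varphi\in\mathcal{S}(\mathbb{R}),\ \exists k\in\mathbb{N},\ \forall\boldsymbol{\xi}\in\mathbb{Z}^n,\ |\langle\varphi,T_{\boldsymbol{\xi}}\rangle|\le k(1+\|\boldsymbol{\xi}\|_1)^k\}.$$ The operator $P\left(\frac{d}{dt},i\boldsymbol{\xi}\right)$ acts componentwise: it sends $(T_{\boldsymbol{\xi}})_{\boldsymbol{\xi}}$ to $\left(P\left(\frac{d}{dt},i\boldsymbol{\xi}\right)T_{\boldsymbol{\xi}}\right)_{\boldsymbol{\xi}}$,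 where for each fixed $\boldsymbol{\xi}$ the polynomial $\tau\mapsto P(\tau,i\boldsymbol{\xi})$ has $\tau$ replaced by the distributional derivative $\frac{d}{dt}$. *)

theory Defs
  imports "HOL-Analysis.Analysis" "HOL-Library.Poly_Mapping" "HOL-Computational_Algebra.Polynomial"
begin

section \<open>The Schwartz space on the real line\<close>

definition nderiv :: "nat \<Rightarrow> (real \<Rightarrow> complex) \<Rightarrow> real \<Rightarrow> complex" where
  "nderiv k f = ((\<lambda>g t. vector_derivative g (at t)) ^^ k) f"

definition smooth :: "(real \<Rightarrow> complex) \<Rightarrow> bool" where
  "smooth f \<longleftrightarrow> (\<forall>k t. nderiv k f differentiable (at t))"

definition rapidly_decreasing :: "(real \<Rightarrow> complex) \<Rightarrow> bool" where
  "rapidly_decreasing f \<longleftrightarrow> (\<forall>j k. bounded (range (\<lambda>t. t ^ j *\<^sub>R nderiv k f t)))"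

lemma nderiv_0 [simp]: "nderiv 0 f = f"
  by (simp add: nderiv_def)

lemma nderiv_Suc: "nderiv (Suc k) f = (\<lambda>t. vector_derivative (nderiv k f) (at t))"
  by (simp add: nderiv_def)

lemma nderiv_Suc': "nderiv k (nderiv (Suc 0) f) = nderiv (Suc k) f"
  by (induction k) (simp_all add: nderiv_Suc)

lemma nderiv_const_0: "nderiv k (\<lambda>_. 0) = (\<lambda>_. 0)"
  by (induction k) (simp_all add: nderiv_Suc)

lemma nderiv_add:
  assumes "smooth f" "smooth g"
  shows "nderiv k (\<lambda>t. f t + g t) = (\<lambda>t. nderiv k f t + nderiv k g t)"
  using assms by (induction k) (auto simp: nderiv_Suc smooth_def)

lemma nderiv_mult:
  assumes "smooth f"
  shows "nderiv k (\<lambda>t. c * f t) = (\<lambda>t. c * nderiv k f t)"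
  using assms by (induction k) (auto simp: nderiv_Suc smooth_def)

typedef schwartz = "{f :: real \<Rightarrow> complex. smooth f \<and> rapidly_decreasing f}"
  by (rule exI[of _ "\<lambda>_. 0"]) (auto simp: smooth_def rapidly_decreasing_def nderiv_const_0)

setup_lifting type_definition_schwartz

lift_definition schwartz_scale :: "complex \<Rightarrow> schwartz \<Rightarrow> schwartz" is "\<lambda>c f t. c * f t"
proof -
  fix c :: complex and f :: "real \<Rightarrow> complex"
  assume f: "smooth f \<and> rapidly_decreasing f"
  have "bounded (range (\<lambda>t. c * (t ^ j *\<^sub>R nderiv k f t)))" for j k
  proof -
    have "bounded ((\<lambda>z. c * z) ` range (\<lambda>t. t ^ j *\<^sub>R nderiv k f t))"
      using f by (intro bounded_linear_image[OF _ bounded_linear_mult_right]) (auto simp: rapidly_decreasing_def)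
    then show ?thesis by (simp add: image_image)
  qed
  with f show "smooth (\<lambda>t. c * f t) \<and> rapidly_decreasing (\<lambda>t. c * f t)"
    by (auto simp: smooth_def rapidly_decreasing_def nderiv_mult[unfolded smooth_def])
qed

lift_definition schwartz_deriv :: "schwartz \<Rightarrow> schwartz" is "nderiv 1"
  by (simp add: smooth_def rapidly_decreasing_def nderiv_Suc')

instantiation schwartz :: ab_group_add
begin

lift_definition zero_schwartz :: schwartz is "\<lambda>_. 0"
  by (auto simp: smooth_def rapidly_decreasing_def nderiv_const_0)

lift_definition plus_schwartz :: "schwartz \<Rightarrow> schwartz \<Rightarrow> schwartz" is "\<lambda>f g t. f t + g t"
  by (auto simp: smooth_def rapidly_decreasing_def nderiv_add[unfolded smooth_def]
      scaleR_add_right intro!: bounded_plus_comp differentiable_add)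

definition uminus_schwartz :: "schwartz \<Rightarrow> schwartz" where
  "uminus_schwartz \<phi> = schwartz_scale (- 1) \<phi>"

definition minus_schwartz :: "schwartz \<Rightarrow> schwartz \<Rightarrow> schwartz" where
  "minus_schwartz \<phi> \<psi> = \<phi> + - \<psi>"

instance
proof
  fix a b c :: schwartz
  show "a + b + c = a + (b + c)" by transfer (simp add: add.assoc)
  show "a + b = b + a" by transfer (simp add: add.commute)
  show "0 + a = a" by transfer simp
  show "- a + a = 0" unfolding uminus_schwartz_def by transfer simp
  show "a - b = a + - b" by (rule minus_schwartz_def)
qed

end

definition schwartz_seminorm :: "nat \<Rightarrow> nat \<Rightarrow> schwartz \<Rightarrow> real" where
  "schwartz_seminorm j k \<phi> = (SUP t. cmod (t ^ j *\<^sub>R nderiv k (Rep_schwartz \<phi>) t))"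

text \<open>The locally convex topology generated by the family of all these seminorms.\<close>

instantiation schwartz :: topological_space
begin

definition open_schwartz :: "schwartz set \<Rightarrow> bool" where
  "open_schwartz U \<longleftrightarrow> (\<forall>\<phi>\<in>U. \<exists>N. \<exists>\<epsilon>>0. \<forall>\<psi>.
     (\<forall>j\<le>N. \<forall>k\<le>N. schwartz_seminorm j k (\<psi> - \<phi>) < \<epsilon>) \<longrightarrow> \<psi> \<in> U)"

instance
proof
  show "open (UNIV :: schwartz set)"
    unfolding open_schwartz_def using zero_less_one by blast
next
  fix S U :: "schwartz set"
  assume S: "open S" and U: "open U"
  show "open (S \<inter> U)"
    unfolding open_schwartz_def
  proof
    fix \<phi> assume "\<phi> \<in> S \<inter> U"
    then have "\<phi> \<in> S" "\<phi> \<in> U" by auto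
    from S[unfolded open_schwartz_def, rule_format, OF \<open>\<phi> \<in> S\<close>] obtain M d where
      d: "d > 0" "\<forall>\<psi>. (\<forall>j\<le>M. \<forall>k\<le>M. schwartz_seminorm j k (\<psi> - \<phi>) < d) \<longrightarrow> \<psi> \<in> S"
      by blast
    from U[unfolded open_schwartz_def, rule_format, OF \<open>\<phi> \<in> U\<close>] obtain N e where
      e: "e > 0" "\<forall>\<psi>. (\<forall>j\<le>N. \<forall>k\<le>N. schwartz_seminorm j k (\<psi> - \<phi>) < e) \<longrightarrow> \<psi> \<in> U"
      by blast
    have "\<psi> \<in> S \<inter> U"
      if "\<forall>j\<le>max M N. \<forall>k\<le>max M N. schwartz_seminorm j k (\<psi> - \<phi>) < min d e" for \<psi>
      using that d(2) e(2) by simp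
    moreover have "min d e > 0" using d(1) e(1) by simp
    ultimately show "\<exists>N. \<exists>\<epsilon>>0. \<forall>\<psi>.
        (\<forall>j\<le>N. \<forall>k\<le>N. schwartz_seminorm j k (\<psi> - \<phi>) < \<epsilon>) \<longrightarrow> \<psi> \<in> S \<inter> U"
      by blast
  qed
next
  fix K :: "schwartz set set"
  assume K: "\<forall>S\<in>K. open S"
  show "open (\<Union>K)"
    unfolding open_schwartz_def
  proof
    fix \<phi> assume "\<phi> \<in> \<Union>K"
    then obtain S where S: "S \<in> K" "\<phi> \<in> S" by blast
    with K have "open S" by blast
    from this[unfolded open_schwartz_def, rule_format, OF S(2)] S(1)
    show "\<exists>N. \<exists>\<epsilon>>0. \<forall>\<psi>.
        (\<forall>j\<le>N. \<forall>k\<le>N. schwartz_seminorm j k (\<psi> - \<phi>) < \<epsilon>) \<longrightarrow> \<psi> \<in> \<Union>K"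
      by (meson UnionI)
  qed
qed

end

section \<open>Tempered distributions\<close>

definition tempered_distributions :: "(schwartz \<Rightarrow> complex) set" where
  "tempered_distributions = {T.
     (\<forall>\<phi> \<psi>. T (\<phi> + \<psi>) = T \<phi> + T \<psi>) \<and>
     (\<forall>c \<phi>. T (schwartz_scale c \<phi>) = c * T \<phi>) \<and>
     continuous_on UNIV T}"

definition dist_deriv :: "(schwartz \<Rightarrow> complex) \<Rightarrow> schwartz \<Rightarrow> complex" where
  "dist_deriv T \<phi> = - T (schwartz_deriv \<phi>)"

definition poly_dist_deriv :: "complex poly \<Rightarrow> (schwartz \<Rightarrow> complex) \<Rightarrow> schwartz \<Rightarrow> complex" where
  "poly_dist_deriv p T \<phi> = (\<Sum>k\<le>degree p. coeff p k * (dist_deriv ^^ k) T \<phi>)"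

section \<open>Families indexed by the integer lattice\<close>

definition norm1 :: "int ^ 'n \<Rightarrow> real" where
  "norm1 \<xi> = (\<Sum>i\<in>UNIV. \<bar>of_int (\<xi> $ i)\<bar>)"

definition poly_growth :: "(int ^ 'n \<Rightarrow> complex) set" where
  "poly_growth = {a. \<exists>k::nat. \<forall>\<xi>. cmod (a \<xi>) \<le> real k * (1 + norm1 \<xi>) ^ k}"

definition Y :: "(int ^ 'n \<Rightarrow> schwartz \<Rightarrow> complex) set" where
  "Y = {T. (\<forall>\<xi>. T \<xi> \<in> tempered_distributions) \<and>
     (\<forall>\<phi>. \<exists>k::nat. \<forall>\<xi>. cmod (T \<xi> \<phi>) \<le> real k * (1 + norm1 \<xi>) ^ k)}"

section \<open>Polynomials in several variables and their symbols\<close>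

text \<open>\<open>('n \<Rightarrow>\<^sub>0 nat) \<Rightarrow>\<^sub>0 complex\<close> is the ring of polynomials in variables indexed by \<open>'n\<close>:
  finitely supported maps from exponent vectors to coefficients.\<close>

definition mpoly_eval :: "(('n::finite \<Rightarrow>\<^sub>0 nat) \<Rightarrow>\<^sub>0 complex) \<Rightarrow> ('n \<Rightarrow> complex) \<Rightarrow> complex" where
  "mpoly_eval q x =
     (\<Sum>m\<in>Poly_Mapping.keys q. Poly_Mapping.lookup q m * (\<Prod>i\<in>UNIV. x i ^ Poly_Mapping.lookup m i))"

definition symbol :: "(('n::finite \<Rightarrow>\<^sub>0 nat) \<Rightarrow>\<^sub>0 complex) poly \<Rightarrow> int ^ 'n \<Rightarrow> complex poly" where
  "symbol P \<xi> = map_poly (\<lambda>q. mpoly_eval q (\<lambda>i. \<i> * of_int (\<xi> $ i))) P"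

definition symbol_operator ::
  "(('n::finite \<Rightarrow>\<^sub>0 nat) \<Rightarrow>\<^sub>0 complex) poly \<Rightarrow>
     (int ^ 'n \<Rightarrow> schwartz \<Rightarrow> complex) \<Rightarrow> int ^ 'n \<Rightarrow> schwartz \<Rightarrow> complex" where
  "symbol_operator P T \<xi> = poly_dist_deriv (symbol P \<xi>) (T \<xi>)"

definition root_distance :: "nat \<Rightarrow> (nat \<Rightarrow> complex) \<Rightarrow> real" where
  "root_distance m r =
     (if \<forall>j\<in>{1..m}. Re (r j) = 0 then 1
      else Min ((\<lambda>j. \<bar>Re (r j)\<bar>) ` {j \<in> {1..m}. Re (r j) \<noteq> 0}))"

end

theory Submission
  imports Defs
begin

text \<open>
  A solution of \<open>(d/dt - \<lambda>) T = S\<close> is \<open>T = - S \<circ> B\<close>, where \<open>B\<close> is any continuous linear left inverse of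
  \<open>d/dt + \<lambda>\<close> on the Schwartz space. For \<open>Re \<lambda> \<noteq> 0\<close> the operator \<open>d/dt + \<lambda>\<close> is bijective and \<open>B\<close> is
  integration against an exponential; for \<open>Re \<lambda> = 0\<close> one first subtracts a multiple of a modulated
  Gaussian to make the integral of \<open>exp (\<lambda> t) \<phi> t\<close> vanish. In both cases the seminorms of \<open>B \<phi>\<close> are
  bounded by seminorms of \<open>\<phi>\<close> times powers of \<open>1 + |\<lambda>|\<close> and of \<open>1 / |Re \<lambda>|\<close> (when \<open>Re \<lambda> \<noteq> 0\<close>). The
  former is polynomially bounded in \<open>\<xi>\<close> by Cauchy's root bound and the growth of \<open>1 / c\<close>, the latter by
  the hypothesis on \<open>d\<close>. Since elements of \<open>Y\<close> satisfy one seminorm estimate with constants of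
  polynomial growth in \<open>\<xi>\<close> (Banach--Steinhaus), the map \<open>S \<mapsto> - S \<circ> B\<close> preserves \<open>Y\<close>, and the roots, whose number is at
  most the degree of \<open>P\<close>, are removed one at a time.
\<close>

section \<open>Weighted bounds on Schwartz functions\<close>

text \<open>Membership in \<open>Y\<close> is a condition on one test function at a time, with an
  exponent that may depend on it, whereas S has to be evaluated at B \<phi>, a test function that
  moves with \<xi> through the root. Hence an estimate uniform in the test function must be
  extracted first, and the bounds for B must depend on the root in an explicit way only. These
  bounds may lose derivatives and powers of the weight: after each root the new family lies in
  \<open>Y\<close> again, so the uniform estimate is derived anew and no seminorm index is carried
  from one factor to the next. A purely imaginary root creates no small denominator, because
  exp(\<lambda> t) is then unimodular; the obstruction is a single integral, and removing it costs
  only powers of 1 + |\<lambda>|.\<close>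

definition decay :: "nat \<Rightarrow> real \<Rightarrow> (real \<Rightarrow> complex) \<Rightarrow> bool" where
  "decay N r f \<longleftrightarrow> (\<forall>t. (1 + \<bar>t\<bar>) ^ N * cmod (f t) \<le> r)"

lemma decayI: "(\<And>t. (1 + \<bar>t\<bar>) ^ N * cmod (f t) \<le> r) \<Longrightarrow> decay N r f"
  by (simp add: decay_def)

lemma decayD: "decay N r f \<Longrightarrow> (1 + \<bar>t\<bar>) ^ N * cmod (f t) \<le> r"
  by (simp add: decay_def)

lemma decay_nonneg: "decay N r f \<Longrightarrow> 0 \<le> r"
  using decayD[of N r f 0] by (simp add: order_trans[OF norm_ge_zero])

lemma decay_antimono:
  assumes "decay N r f" "M \<le> N" "r \<le> s"
  shows "decay M s f"
proof (rule decayI)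
  fix t :: real
  have "(1 + \<bar>t\<bar>) ^ M * cmod (f t) \<le> (1 + \<bar>t\<bar>) ^ N * cmod (f t)"
    using assms(2) by (intro mult_right_mono power_increasing) auto
  also have "\<dots> \<le> s" using decayD[OF assms(1)] assms(3) by (rule order_trans)
  finally show "(1 + \<bar>t\<bar>) ^ M * cmod (f t) \<le> s" .
qed

lemma decay_norm_le:
  assumes "decay N r f"
  shows "cmod (f t) \<le> r"
  using decayD[OF decay_antimono[OF assms le0 order_refl], of t] by simp

lemma decay_add:
  assumes "decay N r f" "decay N s g"
  shows "decay N (r + s) (\<lambda>t. f t + g t)"
proof (rule decayI)
  fix t :: real
  have "(1 + \<bar>t\<bar>) ^ N * cmod (f t + g t) \<le> (1 + \<bar>t\<bar>) ^ N * (cmod (f t) + cmod (g t))"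
    by (intro mult_left_mono norm_triangle_ineq) auto
  then show "(1 + \<bar>t\<bar>) ^ N * cmod (f t + g t) \<le> r + s"
    using decayD[OF assms(1), of t] decayD[OF assms(2), of t] by (simp add: distrib_left)
qed

lemma decay_mult:
  assumes "decay N r f" "\<And>t. cmod (c t) \<le> C"
  shows "decay N (C * r) (\<lambda>t. c t * f t)"
proof (rule decayI)
  fix t :: real
  have "cmod (c t) * ((1 + \<bar>t\<bar>) ^ N * cmod (f t)) \<le> C * r"
    using decayD[OF assms(1)] assms(2) decay_nonneg[OF assms(1)]
    by (intro mult_mono) (auto intro: order_trans[OF norm_ge_zero])
  then show "(1 + \<bar>t\<bar>) ^ N * cmod (c t * f t) \<le> C * r"
    by (simp add: norm_mult mult_ac)
qed

section \<open>Smooth functions given by the full sequence of their derivatives\<close>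

lemma smooth_has_vector_derivative:
  "smooth f \<Longrightarrow> (nderiv k f has_vector_derivative nderiv (Suc k) f t) (at t)"
  by (simp add: smooth_def nderiv_Suc vector_derivative_works)

text \<open>A function built by hand is easiest to certify when all its derivatives are exhibited at
  once. Limits, solutions of differential equations, the Gaussian and its modulations all enter the
  Schwartz space this way, through \<open>schwartz_of_tower\<close>.\<close>

lemma nderiv_tower:
  assumes "\<And>k t. (F k has_vector_derivative F (Suc k) t) (at t)"
  shows "nderiv k (F 0) = F k"
proof (induction k)
  case (Suc k)
  then show ?case
    using assms[of k] by (auto simp: nderiv_Suc vector_derivative_at)
qed simp

lemma smooth_tower:
  assumes "\<And>k t. (F k has_vector_derivative F (Suc k) t) (at t)"
  shows "smooth (F 0)"
  unfolding smooth_def nderiv_tower[of F, OF assms] using assms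
  by (blast intro: differentiableI_vector)

lemma one_plus_power_le: "(1 + x) ^ N \<le> 2 ^ N * (1 + x ^ N)" if "0 \<le> x" for x :: real
proof -
  have "(1 + x) ^ N \<le> (2 * max 1 x) ^ N" using that by (intro power_mono) auto
  also have "\<dots> = 2 ^ N * max 1 x ^ N" by (rule power_mult_distrib)
  also have "\<dots> \<le> 2 ^ N * (1 + x ^ N)" using that by (intro mult_left_mono) (auto simp: max_def)
  finally show ?thesis .
qed

lemma rapidly_decreasing_iff_decay:
  "rapidly_decreasing f \<longleftrightarrow> (\<forall>N k. \<exists>C. decay N C (nderiv k f))"
proof
  assume f: "rapidly_decreasing f"
  show "\<forall>N k. \<exists>C. decay N C (nderiv k f)"
  proof (intro allI)
    fix N k
    have "bounded (range (\<lambda>t. t ^ 0 *\<^sub>R nderiv k f t))"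
      using f unfolding rapidly_decreasing_def by blast
    then obtain A where A: "\<And>t. cmod (t ^ 0 *\<^sub>R nderiv k f t) \<le> A"
      by (auto simp: bounded_iff)
    have "bounded (range (\<lambda>t. t ^ N *\<^sub>R nderiv k f t))"
      using f unfolding rapidly_decreasing_def by blast
    then obtain B where B: "\<And>t. cmod (t ^ N *\<^sub>R nderiv k f t) \<le> B"
      by (auto simp: bounded_iff)
    have "decay N (2 ^ N * (A + B)) (nderiv k f)"
    proof (rule decayI)
      fix t :: real
      have "(1 + \<bar>t\<bar>) ^ N * cmod (nderiv k f t) \<le> 2 ^ N * (1 + \<bar>t\<bar> ^ N) * cmod (nderiv k f t)"
        by (intro mult_right_mono one_plus_power_le) auto
      also have "\<dots> = 2 ^ N * (cmod (t ^ 0 *\<^sub>R nderiv k f t) + cmod (t ^ N *\<^sub>R nderiv k f t))"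
        by (simp add: algebra_simps power_abs)
      also have "\<dots> \<le> 2 ^ N * (A + B)" using A B by (intro mult_left_mono add_mono) auto
      finally show "(1 + \<bar>t\<bar>) ^ N * cmod (nderiv k f t) \<le> 2 ^ N * (A + B)" .
    qed
    then show "\<exists>C. decay N C (nderiv k f)" by blast
  qed
next
  assume f: "\<forall>N k. \<exists>C. decay N C (nderiv k f)"
  show "rapidly_decreasing f"
    unfolding rapidly_decreasing_def bounded_iff
  proof (intro allI)
    fix j k
    from f obtain C where C: "decay j C (nderiv k f)" by blast
    have "cmod (t ^ j *\<^sub>R nderiv k f t) \<le> C" for t
    proof -
      have "cmod (t ^ j *\<^sub>R nderiv k f t) = \<bar>t\<bar> ^ j * cmod (nderiv k f t)" by (simp add: power_abs)
      also have "\<dots> \<le> (1 + \<bar>t\<bar>) ^ j * cmod (nderiv k f t)"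
        by (intro mult_right_mono power_mono) auto
      also have "\<dots> \<le> C" by (rule decayD[OF C])
      finally show ?thesis .
    qed
    then show "\<exists>a. \<forall>x\<in>range (\<lambda>t. t ^ j *\<^sub>R nderiv k f t). cmod x \<le> a" by blast
  qed
qed

abbreviation sder :: "nat \<Rightarrow> schwartz \<Rightarrow> real \<Rightarrow> complex" where
  "sder k \<phi> \<equiv> nderiv k (Rep_schwartz \<phi>)"

lemma smooth_Rep_schwartz: "smooth (Rep_schwartz \<phi>)"
  using Rep_schwartz[of \<phi>] by simp

lemma sder_has_vector_derivative: "(sder k \<phi> has_vector_derivative sder (Suc k) \<phi> t) (at t)"
  by (rule smooth_has_vector_derivative[OF smooth_Rep_schwartz])

lemma sder_add: "sder k (\<phi> + \<psi>) = (\<lambda>t. sder k \<phi> t + sder k \<psi> t)"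
  using nderiv_add[OF smooth_Rep_schwartz smooth_Rep_schwartz] by (simp add: plus_schwartz.rep_eq)

lemma sder_scale: "sder k (schwartz_scale c \<phi>) = (\<lambda>t. c * sder k \<phi> t)"
  using nderiv_mult[OF smooth_Rep_schwartz] by (simp add: schwartz_scale.rep_eq)

lemma sder_zero: "sder k 0 = (\<lambda>t. 0)"
  by (simp add: zero_schwartz.rep_eq nderiv_const_0)

lemma sder_minus: "sder k (\<phi> - \<psi>) = (\<lambda>t. sder k \<phi> t - sder k \<psi> t)"
  by (simp add: minus_schwartz_def uminus_schwartz_def sder_add sder_scale)

lemma sder_deriv: "sder k (schwartz_deriv \<phi>) = sder (Suc k) \<phi>"
  by (simp add: schwartz_deriv.rep_eq nderiv_Suc')

lemma schwartz_eqI: "(\<And>t. sder 0 \<phi> t = sder 0 \<psi> t) \<Longrightarrow> \<phi> = \<psi>"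
  by (simp add: Rep_schwartz_inject[symmetric] fun_eq_iff)

lemma schwartz_of_tower:
  assumes "\<And>k t. (F k has_vector_derivative F (Suc k) t) (at t)"
    and "\<And>N k. \<exists>C. decay N C (F k)"
  obtains \<phi> where "\<And>k. sder k \<phi> = F k"
proof
  have "Rep_schwartz (Abs_schwartz (F 0)) = F 0"
    using smooth_tower[of F, OF assms(1)] assms(2)
    by (intro Abs_schwartz_inverse) (simp add: rapidly_decreasing_iff_decay nderiv_tower[of F, OF assms(1)])
  then show "\<And>k. sder k (Abs_schwartz (F 0)) = F k"
    by (simp add: nderiv_tower[of F, OF assms(1)])
qed

text \<open>Stands for p_N(\<phi>) \<le> r, where p_N is the largest weighted supremum of the
  derivatives up to order N. As a predicate it avoids suprema, and since it gets stronger with N,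
  one index replaces the double family \<open>schwartz_seminorm\<close>.\<close>

definition wbound :: "nat \<Rightarrow> real \<Rightarrow> schwartz \<Rightarrow> bool" where
  "wbound N r \<phi> \<longleftrightarrow> (\<forall>k\<le>N. decay N r (sder k \<phi>))"

lemma wbound_nonneg: "wbound N r \<phi> \<Longrightarrow> 0 \<le> r"
  unfolding wbound_def using decay_nonneg by blast

lemma wbound_antimono: "wbound N r \<phi> \<Longrightarrow> M \<le> N \<Longrightarrow> r \<le> s \<Longrightarrow> wbound M s \<phi>"
  unfolding wbound_def by (meson decay_antimono le_trans)

lemma wbound_add: "wbound N r \<phi> \<Longrightarrow> wbound N s \<psi> \<Longrightarrow> wbound N (r + s) (\<phi> + \<psi>)"
  unfolding wbound_def sder_add by (simp add: decay_add)

lemma wbound_scale: "wbound N r \<phi> \<Longrightarrow> wbound N (cmod c * r) (schwartz_scale c \<phi>)"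
  unfolding wbound_def sder_scale by (simp add: decay_mult)

lemma wbound_uminus: "wbound N r \<phi> \<Longrightarrow> wbound N r (- \<phi>)"
  using wbound_scale[of N r \<phi> "-1"] by (simp add: uminus_schwartz_def)

lemma wbound_minus: "wbound N r \<phi> \<Longrightarrow> wbound N s \<psi> \<Longrightarrow> wbound N (r + s) (\<phi> - \<psi>)"
  unfolding minus_schwartz_def by (intro wbound_add wbound_uminus)

lemma wbound_zero: "0 \<le> r \<Longrightarrow> wbound N r 0"
  by (simp add: wbound_def sder_zero decay_def)

lemma wbound_deriv: "wbound (Suc N) r \<phi> \<Longrightarrow> wbound N r (schwartz_deriv \<phi>)"
  unfolding wbound_def sder_deriv
  by (metis Suc_le_mono decay_antimono le_SucI order_refl)

lemma ex_wbound: "\<exists>r>0. wbound N r \<phi>"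
proof -
  have "\<forall>k. \<exists>C. decay N C (sder k \<phi>)"
    using Rep_schwartz[of \<phi>] by (auto simp: rapidly_decreasing_iff_decay)
  then obtain C where C: "\<And>k. decay N (C k) (sder k \<phi>)" by metis
  have "decay N (1 + (\<Sum>k\<le>N. \<bar>C k\<bar>)) (sder k \<phi>)" if "k \<le> N" for k
  proof (rule decay_antimono[OF C order_refl])
    have "C k \<le> \<bar>C k\<bar>" by simp
    also have "\<dots> \<le> (\<Sum>k\<le>N. \<bar>C k\<bar>)" using that by (intro member_le_sum) auto
    finally show "C k \<le> 1 + (\<Sum>k\<le>N. \<bar>C k\<bar>)" by simp
  qed
  moreover have "0 < 1 + (\<Sum>k\<le>N. \<bar>C k\<bar>)" by (simp add: add_pos_nonneg sum_nonneg)
  ultimately show ?thesis unfolding wbound_def by blast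
qed

lemma decay_imp_seminorm_le:
  assumes "decay j r (sder k \<phi>)"
  shows "schwartz_seminorm j k \<phi> \<le> r"
  unfolding schwartz_seminorm_def
proof (rule cSUP_least)
  fix t :: real
  have "cmod (t ^ j *\<^sub>R sder k \<phi> t) = \<bar>t\<bar> ^ j * cmod (sder k \<phi> t)" by (simp add: power_abs)
  also have "\<dots> \<le> (1 + \<bar>t\<bar>) ^ j * cmod (sder k \<phi> t)"
    by (intro mult_right_mono power_mono) auto
  also have "\<dots> \<le> r" by (rule decayD[OF assms])
  finally show "cmod (t ^ j *\<^sub>R sder k \<phi> t) \<le> r" .
qed simp

lemma seminorm_ge: "\<bar>t\<bar> ^ j * cmod (sder k \<phi> t) \<le> schwartz_seminorm j k \<phi>"
proof -
  have "bounded (range (\<lambda>t. t ^ j *\<^sub>R sder k \<phi> t))"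
    using Rep_schwartz[of \<phi>] by (simp add: rapidly_decreasing_def)
  then have "bdd_above (range (\<lambda>t. cmod (t ^ j *\<^sub>R sder k \<phi> t)))"
    unfolding bounded_iff bdd_above_def by blast
  from cSUP_upper[OF UNIV_I this, of t] show ?thesis
    unfolding schwartz_seminorm_def by (simp add: power_abs)
qed

lemma seminorm_less_imp_wbound:
  assumes "\<forall>j\<le>N. \<forall>k\<le>N. schwartz_seminorm j k \<phi> < e"
  shows "wbound N (2 ^ N * (2 * e)) \<phi>"
  unfolding wbound_def
proof (intro allI impI decayI)
  fix k t assume k: "k \<le> N"
  have "(1 + \<bar>t\<bar>) ^ N * cmod (sder k \<phi> t) \<le> 2 ^ N * (1 + \<bar>t\<bar> ^ N) * cmod (sder k \<phi> t)"
    by (intro mult_right_mono one_plus_power_le) auto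
  also have "\<dots> = 2 ^ N * (\<bar>t\<bar> ^ 0 * cmod (sder k \<phi> t) + \<bar>t\<bar> ^ N * cmod (sder k \<phi> t))"
    by (simp add: algebra_simps)
  also have "\<dots> \<le> 2 ^ N * (e + e)"
  proof (intro mult_left_mono add_mono)
    show "\<bar>t\<bar> ^ 0 * cmod (sder k \<phi> t) \<le> e"
      using seminorm_ge[of t 0 k \<phi>] assms k by (meson le0 less_imp_le order_trans)
    show "\<bar>t\<bar> ^ N * cmod (sder k \<phi> t) \<le> e"
      using seminorm_ge[of t N k \<phi>] assms k by (meson order_refl less_imp_le order_trans)
  qed simp
  finally show "(1 + \<bar>t\<bar>) ^ N * cmod (sder k \<phi> t) \<le> 2 ^ N * (2 * e)" by simp
qed

text \<open>The weight (1 + |t|)^N dominates |t|^j for j \<le> N and is itself at most 2^N (1 +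
  |t|^N), so both families of seminorms give the same neighbourhoods up to a change of
  radius.\<close>

lemma open_schwartz_iff_wbound:
  "open U \<longleftrightarrow> (\<forall>\<phi>\<in>U. \<exists>N. \<exists>e>0. \<forall>\<psi>. wbound N e (\<psi> - \<phi>) \<longrightarrow> \<psi> \<in> U)"
proof
  assume U: "open U"
  show "\<forall>\<phi>\<in>U. \<exists>N. \<exists>e>0. \<forall>\<psi>. wbound N e (\<psi> - \<phi>) \<longrightarrow> \<psi> \<in> U"
  proof
    fix \<phi> assume "\<phi> \<in> U"
    then obtain N e where e: "e > 0"
        "\<And>\<psi>. (\<forall>j\<le>N. \<forall>k\<le>N. schwartz_seminorm j k (\<psi> - \<phi>) < e) \<Longrightarrow> \<psi> \<in> U"
      using U unfolding open_schwartz_def by metis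
    have "\<psi> \<in> U" if "wbound N (e / 2) (\<psi> - \<phi>)" for \<psi>
    proof (rule e(2), intro allI impI)
      fix j k assume "j \<le> N" "k \<le> N"
      then have "schwartz_seminorm j k (\<psi> - \<phi>) \<le> e / 2"
        using that unfolding wbound_def by (intro decay_imp_seminorm_le) (meson decay_antimono order_refl)
      then show "schwartz_seminorm j k (\<psi> - \<phi>) < e" using e(1) by simp
    qed
    then show "\<exists>N. \<exists>e>0. \<forall>\<psi>. wbound N e (\<psi> - \<phi>) \<longrightarrow> \<psi> \<in> U"
      using e(1) by (meson half_gt_zero)
  qed
next
  assume U: "\<forall>\<phi>\<in>U. \<exists>N. \<exists>e>0. \<forall>\<psi>. wbound N e (\<psi> - \<phi>) \<longrightarrow> \<psi> \<in> U"
  show "open U"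
    unfolding open_schwartz_def
  proof
    fix \<phi> assume "\<phi> \<in> U"
    then obtain N e where e: "e > 0" "\<And>\<psi>. wbound N e (\<psi> - \<phi>) \<Longrightarrow> \<psi> \<in> U"
      using U by meson
    have "\<psi> \<in> U" if "\<forall>j\<le>N. \<forall>k\<le>N. schwartz_seminorm j k (\<psi> - \<phi>) < e / (2 ^ N * 2)" for \<psi>
      using seminorm_less_imp_wbound[OF that] e by simp
    moreover have "0 < e / (2 ^ N * 2)" using e(1) by simp
    ultimately show "\<exists>N. \<exists>e>0. \<forall>\<psi>.
        (\<forall>j\<le>N. \<forall>k\<le>N. schwartz_seminorm j k (\<psi> - \<phi>) < e) \<longrightarrow> \<psi> \<in> U" by blast
  qed
qed

section \<open>Continuity of linear functionals as an estimate\<close>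

definition schwartz_linear :: "(schwartz \<Rightarrow> complex) \<Rightarrow> bool" where
  "schwartz_linear T \<longleftrightarrow> (\<forall>\<phi> \<psi>. T (\<phi> + \<psi>) = T \<phi> + T \<psi>) \<and> (\<forall>c \<phi>. T (schwartz_scale c \<phi>) = c * T \<phi>)"

lemma schwartz_linear_minus: "schwartz_linear T \<Longrightarrow> T (\<phi> - \<psi>) = T \<phi> - T \<psi>"
  by (simp add: schwartz_linear_def minus_schwartz_def uminus_schwartz_def)

text \<open>By homogeneity a bound on one ball gives a bound on all balls. Scaling needs a positive
  radius while \<open>r\<close> may be 0, so the estimate is proved for s > 0 and then used for s
  slightly above \<open>r\<close>.\<close>

lemma schwartz_linear_bound:
  assumes T: "schwartz_linear T" and e: "e > 0" and K: "\<And>\<phi>. wbound N e \<phi> \<Longrightarrow> cmod (T \<phi>) \<le> K"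
    and \<phi>: "wbound N r \<phi>"
  shows "cmod (T \<phi>) \<le> K / e * r"
proof -
  have K0: "0 \<le> K" using order_trans[OF norm_ge_zero K[OF wbound_zero]] e by simp
  have *: "cmod (T \<phi>) \<le> K / e * s" if "s > 0" "wbound N s \<phi>" for s
  proof -
    have "wbound N e (schwartz_scale (of_real (e / s)) \<phi>)"
      using wbound_scale[OF that(2), of "of_real (e / s)"] that(1) e by (simp add: norm_divide)
    then have "cmod (of_real (e / s) * T \<phi>) \<le> K" using K T by (metis schwartz_linear_def)
    then have "e / s * cmod (T \<phi>) \<le> K" using that(1) e by (simp add: norm_mult norm_divide)
    then show ?thesis using that(1) e by (simp add: field_simps)
  qed
  show ?thesis
  proof (rule field_le_epsilon)
    fix d :: real assume d: "d > 0"
    \<comment> \<open>The excess over \<open>r\<close> is chosen so that multiplication by K / e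
      turns it into at most d; K + 1 keeps the denominator positive when K = 0.\<close>
    define s where "s = r + d * e / (K + 1)"
    have "0 < d * e / (K + 1)" using d e K0 by simp
    then have s: "s > 0" "r \<le> s" using wbound_nonneg[OF \<phi>] by (auto simp: s_def)
    have "cmod (T \<phi>) \<le> K / e * s" using s wbound_antimono[OF \<phi> order_refl] by (intro *) auto
    also have "\<dots> = K / e * r + d * (K / (K + 1))" using e K0 by (simp add: s_def field_simps)
    also have "\<dots> \<le> K / e * r + d" using d K0 by (simp add: field_simps)
    finally show "cmod (T \<phi>) \<le> K / e * r + d" .
  qed
qed

lemma tempered_iff:
  "T \<in> tempered_distributions \<longleftrightarrow>
     schwartz_linear T \<and> (\<exists>N C. \<forall>r \<phi>. wbound N r \<phi> \<longrightarrow> cmod (T \<phi>) \<le> C * r)"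
proof
  assume T: "T \<in> tempered_distributions"
  then have lin: "schwartz_linear T" and cont: "continuous_on UNIV T"
    by (auto simp: tempered_distributions_def schwartz_linear_def)
  have T0: "T 0 = 0" using lin schwartz_linear_minus[of T 0 0] by simp
  have "open (T -` ball 0 1)" using cont by (simp add: continuous_on_open_vimage)
  then have "\<exists>N. \<exists>e>0. \<forall>\<psi>. wbound N e (\<psi> - 0) \<longrightarrow> \<psi> \<in> T -` ball 0 1"
    unfolding open_schwartz_iff_wbound by (rule bspec) (simp add: T0)
  then obtain N e where e: "e > 0" "\<And>\<phi>. wbound N e \<phi> \<Longrightarrow> cmod (T \<phi>) \<le> 1"
    by (metis diff_zero vimageE mem_ball_0 less_imp_le)
  then show "schwartz_linear T \<and> (\<exists>N C. \<forall>r \<phi>. wbound N r \<phi> \<longrightarrow> cmod (T \<phi>) \<le> C * r)"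
    using schwartz_linear_bound[OF lin e] lin by blast
next
  assume "schwartz_linear T \<and> (\<exists>N C. \<forall>r \<phi>. wbound N r \<phi> \<longrightarrow> cmod (T \<phi>) \<le> C * r)"
  then obtain N C where lin: "schwartz_linear T"
    and C: "\<And>r \<phi>. wbound N r \<phi> \<Longrightarrow> cmod (T \<phi>) \<le> C * r" by blast
  have "open (T -` U)" if U: "open U" for U
    unfolding open_schwartz_iff_wbound
  proof
    fix \<phi> assume "\<phi> \<in> T -` U"
    then obtain e where e: "e > 0" "ball (T \<phi>) e \<subseteq> U" using openE[OF U, of "T \<phi>"] by auto
    have "\<psi> \<in> T -` U" if "wbound N (e / (\<bar>C\<bar> + 1)) (\<psi> - \<phi>)" for \<psi>
    proof -
      have "cmod (T \<psi> - T \<phi>) \<le> C * (e / (\<bar>C\<bar> + 1))"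
        using C[OF that] by (simp add: schwartz_linear_minus[OF lin])
      also have "\<dots> < e" using e(1) by (simp add: field_simps abs_if mult_strict_right_mono split: if_splits)
      finally show ?thesis using e(2) by (auto simp: dist_norm norm_minus_commute)
    qed
    moreover have "0 < e / (\<bar>C\<bar> + 1)" using e(1) by simp
    ultimately show "\<exists>N. \<exists>e>0. \<forall>\<psi>. wbound N e (\<psi> - \<phi>) \<longrightarrow> \<psi> \<in> T -` U" by blast
  qed
  then show "T \<in> tempered_distributions"
    using lin by (simp add: tempered_distributions_def schwartz_linear_def continuous_on_open_vimage)
qed

section \<open>Completeness and uniform boundedness\<close>

lemma decay_limit:
  assumes "\<And>n. n \<ge> M \<Longrightarrow> decay N r (f n)" "\<And>t. (\<lambda>n. f n t) \<longlonglongrightarrow> g t"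
  shows "decay N r g"
proof (rule decayI)
  fix t :: real
  have "(\<lambda>n. (1 + \<bar>t\<bar>) ^ N * cmod (f n t)) \<longlonglongrightarrow> (1 + \<bar>t\<bar>) ^ N * cmod (g t)"
    by (intro tendsto_intros assms(2))
  then show "(1 + \<bar>t\<bar>) ^ N * cmod (g t) \<le> r"
    using decayD[OF assms(1)] by (intro LIMSEQ_le_const2) blast+
qed

lemma wbound_norm_le: "wbound k e \<phi> \<Longrightarrow> cmod (sder k \<phi> t) \<le> e"
  unfolding wbound_def by (blast intro: decay_norm_le)

text \<open>Uniform convergence of the next derivative permits termwise differentiation, so the
  pointwise limits form a tower. The conclusion records pointwise convergence only, which is enough
  because weighted bounds survive pointwise limits (\<open>decay_limit\<close>).\<close>

lemma schwartz_complete: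
  fixes x :: "nat \<Rightarrow> schwartz"
  assumes Cauchy: "\<And>N e. e > 0 \<Longrightarrow> \<exists>M. \<forall>m\<ge>M. \<forall>n\<ge>M. wbound N e (x m - x n)"
  obtains \<phi> where "\<And>k t. (\<lambda>n. sder k (x n) t) \<longlonglongrightarrow> sder k \<phi> t"
proof -
  have "\<exists>g. \<forall>t. (\<lambda>n. sder k (x n) t) \<longlonglongrightarrow> g t" for k
  proof -
    have "\<exists>l. (\<lambda>n. sder k (x n) t) \<longlonglongrightarrow> l" for t
    proof -
      have "Cauchy (\<lambda>n. sder k (x n) t)"
      proof (rule metric_CauchyI)
        fix e :: real assume "e > 0"
        then obtain M where M: "\<And>m n. m \<ge> M \<Longrightarrow> n \<ge> M \<Longrightarrow> wbound k (e / 2) (x m - x n)"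
          using Cauchy[of "e / 2" k] by auto
        have "dist (sder k (x m) t) (sder k (x n) t) < e" if "m \<ge> M" "n \<ge> M" for m n
          using wbound_norm_le[OF M[OF that], of t] \<open>e > 0\<close> by (simp add: sder_minus dist_norm)
        then show "\<exists>M. \<forall>m\<ge>M. \<forall>n\<ge>M. dist (sder k (x m) t) (sder k (x n) t) < e" by blast
      qed
      then show ?thesis by (simp add: Cauchy_convergent_iff convergent_def)
    qed
    then show ?thesis by metis
  qed
  then obtain g where g: "\<And>k t. (\<lambda>n. sder k (x n) t) \<longlonglongrightarrow> g k t" by metis
  \<comment> \<open>Letting the second index tend to infinity in the Cauchy condition upgrades
    pointwise convergence to convergence uniform in t with any weight.\<close>
  have close: "\<exists>M. \<forall>m\<ge>M. decay N e (\<lambda>t. sder k (x m) t - g k t)" if e: "e > 0" for N k e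
  proof -
    obtain M where M: "\<And>m n. m \<ge> M \<Longrightarrow> n \<ge> M \<Longrightarrow> wbound (max N k) e (x m - x n)"
      using Cauchy[OF e] by blast
    have "decay N e (\<lambda>t. sder k (x m) t - g k t)" if m: "m \<ge> M" for m
    proof (rule decay_limit)
      show "(\<lambda>n. sder k (x m) t - sder k (x n) t) \<longlonglongrightarrow> sder k (x m) t - g k t" for t
        by (intro tendsto_intros g)
      show "decay N e (\<lambda>t. sder k (x m) t - sder k (x n) t)" if "n \<ge> M" for n
      proof (rule decay_antimono)
        show "decay (max N k) e (\<lambda>t. sder k (x m) t - sder k (x n) t)"
          using M[OF m that] by (simp add: wbound_def sder_minus)
      qed auto
    qed
    then show ?thesis by blast
  qed
  have deriv: "(g k has_vector_derivative g (Suc k) t) (at t)" for k t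
  proof -
    have "\<exists>h. \<forall>t\<in>UNIV. (\<lambda>n. sder k (x n) t) \<longlonglongrightarrow> h t \<and>
        (h has_derivative (\<lambda>s. s *\<^sub>R g (Suc k) t)) (at t within UNIV)"
    proof (rule has_derivative_sequence)
      show "(sder k (x n) has_derivative (\<lambda>s. s *\<^sub>R sder (Suc k) (x n) t)) (at t within UNIV)" for n t
        using sder_has_vector_derivative by (simp add: has_vector_derivative_def)
      show "(\<lambda>n. sder k (x n) 0) \<longlonglongrightarrow> g k 0" by (rule g)
      fix e :: real assume "e > 0"
      then obtain M where M: "\<And>m. m \<ge> M \<Longrightarrow> decay 0 e (\<lambda>t. sder (Suc k) (x m) t - g (Suc k) t)"
        using close by blast
      have "norm (s *\<^sub>R sder (Suc k) (x n) t - s *\<^sub>R g (Suc k) t) \<le> e * norm s" if "n \<ge> M" for n t s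
      proof -
        have "norm (s *\<^sub>R sder (Suc k) (x n) t - s *\<^sub>R g (Suc k) t)
          = \<bar>s\<bar> * cmod (sder (Suc k) (x n) t - g (Suc k) t)"
          by (simp only: scaleR_diff_right[symmetric] norm_scaleR)
        also have "\<dots> \<le> \<bar>s\<bar> * e" by (intro mult_left_mono decay_norm_le[OF M[OF that]]) auto
        finally show ?thesis by (simp add: mult.commute)
      qed
      then show "\<forall>\<^sub>F n in sequentially. \<forall>t\<in>UNIV. \<forall>s.
          norm (s *\<^sub>R sder (Suc k) (x n) t - s *\<^sub>R g (Suc k) t) \<le> e * norm s"
        unfolding eventually_sequentially by blast
    qed auto
    then obtain h where h: "\<And>t. (\<lambda>n. sder k (x n) t) \<longlonglongrightarrow> h t"
        "\<And>t. (h has_derivative (\<lambda>s. s *\<^sub>R g (Suc k) t)) (at t)" by auto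
    have "h = g k" using LIMSEQ_unique[OF h(1) g] by (simp add: fun_eq_iff)
    with h(2) show ?thesis by (simp add: has_vector_derivative_def)
  qed
  have "\<exists>C. decay N C (g k)" for N k
  proof -
    obtain M where M: "\<And>m. m \<ge> M \<Longrightarrow> decay N 1 (\<lambda>t. sder k (x m) t - g k t)"
      using close[of 1 N k] by auto
    obtain r where r: "wbound (max N k) r (x M)" using ex_wbound by blast
    have "decay N r (sder k (x M))"
      using r unfolding wbound_def by (meson decay_antimono max.cobounded1 max.cobounded2 order_refl)
    from decay_add[OF this decay_mult[OF M[OF order_refl], of "\<lambda>_. -1" 1]]
    show ?thesis by auto
  qed
  with deriv obtain \<phi> where "\<And>k. sder k \<phi> = g k" using schwartz_of_tower[of g] by blast
  then show ?thesis by (intro that[of \<phi>]) (simp add: g)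
qed

text \<open>The nested-ball argument of the Baire category theorem, run directly on the balls of
  \<open>wbound\<close>: if the claim fails, every ball contains a smaller one on which some \<open>S \<xi>\<close> exceeds any
  prescribed polynomial bound.\<close>

lemma uniform_tempered_bound:
  fixes S :: "'i \<Rightarrow> schwartz \<Rightarrow> complex" and q :: "'i \<Rightarrow> real"
  assumes temp: "\<And>\<xi>. S \<xi> \<in> tempered_distributions"
    and bd: "\<And>\<phi>. \<exists>k::nat. \<forall>\<xi>. cmod (S \<xi> \<phi>) \<le> real k * q \<xi> ^ k"
  shows "\<exists>C k N. \<forall>\<xi> r \<phi>. wbound N r \<phi> \<longrightarrow> cmod (S \<xi> \<phi>) \<le> C * q \<xi> ^ k * r"
proof (rule ccontr)
  assume contra: "\<not> ?thesis"
  have lin: "schwartz_linear (S \<xi>)" for \<xi> using temp tempered_iff by blast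
  have shrink: "\<exists>x' N' e' \<xi>. e' > 0 \<and> e' \<le> e / 2 \<and> Suc N \<le> N' \<and>
      (\<forall>\<phi>. wbound N' e' (\<phi> - x') \<longrightarrow> wbound N e (\<phi> - x) \<and> cmod (S \<xi> \<phi>) > real i * q \<xi> ^ i)"
    if e: "e > 0" for x N e i
  proof -
    have "\<exists>\<phi> \<xi>. wbound N (e / 2) (\<phi> - x) \<and> cmod (S \<xi> \<phi>) > real i * q \<xi> ^ i"
    proof (rule ccontr)
      assume neg: "\<not> ?thesis"
      \<comment> \<open>If the bound held on the whole half-size ball about x, subtracting the value
        at the centre would carry it, doubled, to the ball about 0, and homogeneity would give the
        very estimate assumed to fail.\<close>
      have le: "cmod (S \<xi> \<phi>) \<le> real i * q \<xi> ^ i" if "wbound N (e / 2) (\<phi> - x)" for \<phi> \<xi>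
        using neg that not_less by blast
      have "cmod (S \<xi> \<phi>) \<le> 4 * real i / e * q \<xi> ^ i * r" if r: "wbound N r \<phi>" for \<xi> r \<phi>
      proof -
        have "cmod (S \<xi> \<psi>) \<le> 2 * (real i * q \<xi> ^ i)" if "wbound N (e / 2) \<psi>" for \<psi>
        proof -
          have "S \<xi> \<psi> = S \<xi> (x + \<psi>) - S \<xi> x" using lin[of \<xi>] by (simp add: schwartz_linear_def)
          then have "cmod (S \<xi> \<psi>) \<le> cmod (S \<xi> (x + \<psi>)) + cmod (S \<xi> x)"
            by (simp add: norm_triangle_ineq4)
          also have "\<dots> \<le> real i * q \<xi> ^ i + real i * q \<xi> ^ i"
            using e that by (intro add_mono le) (simp_all add: wbound_zero)
          finally show ?thesis by simp
        qed
        from schwartz_linear_bound[OF lin half_gt_zero[OF e] this r]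
        have "cmod (S \<xi> \<phi>) \<le> 2 * (real i * q \<xi> ^ i) / (e / 2) * r" .
        then show ?thesis by simp
      qed
      with contra show False by blast
    qed
    then obtain x' \<xi> where x': "wbound N (e / 2) (x' - x)" and big: "cmod (S \<xi> x') > real i * q \<xi> ^ i"
      by blast
    obtain N1 C where C: "\<And>r \<phi>. wbound N1 r \<phi> \<Longrightarrow> cmod (S \<xi> \<phi>) \<le> C * r"
      using temp[of \<xi>] unfolding tempered_iff by blast
    define d where "d = cmod (S \<xi> x') - real i * q \<xi> ^ i"
    \<comment> \<open>On a ball of this radius and of order at least \<open>N1\<close>, the
      functional \<open>S \<xi>\<close> varies by less than the excess \<open>d\<close>;
      \<open>C\<close> may have either sign.\<close>
    define e' where "e' = min (e / 2) (d / (\<bar>C\<bar> + 1))"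
    have d: "d > 0" using big by (simp add: d_def)
    have e': "e' > 0" "e' \<le> e / 2" "e' \<le> d / (\<bar>C\<bar> + 1)"
      unfolding e'_def using e d by (simp, intro min.cobounded1, intro min.cobounded2)
    have "wbound N e (\<phi> - x) \<and> cmod (S \<xi> \<phi>) > real i * q \<xi> ^ i"
      if \<phi>: "wbound (max (Suc N) N1) e' (\<phi> - x')" for \<phi>
    proof
      have "wbound N (e / 2 + e / 2) ((\<phi> - x') + (x' - x))"
        using wbound_antimono[OF \<phi>, of N "e / 2"] e'(2) x' by (intro wbound_add) auto
      then show "wbound N e (\<phi> - x)" by simp
      have "cmod (S \<xi> (\<phi> - x')) \<le> C * e'" by (intro C wbound_antimono[OF \<phi>]) auto
      also have "\<dots> \<le> \<bar>C\<bar> * (d / (\<bar>C\<bar> + 1))" using e' by (intro mult_mono) auto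
      also have "\<dots> < d" using d by (simp add: field_simps)
      finally have "cmod (S \<xi> \<phi> - S \<xi> x') < d" by (simp add: schwartz_linear_minus[OF lin])
      moreover have "cmod (S \<xi> x') \<le> cmod (S \<xi> \<phi>) + cmod (S \<xi> \<phi> - S \<xi> x')"
        by (metis norm_minus_commute norm_triangle_sub add.commute)
      ultimately show "cmod (S \<xi> \<phi>) > real i * q \<xi> ^ i" by (simp add: d_def)
    qed
    with e' show ?thesis by (metis max.cobounded1)
  qed
  \<comment> \<open>The index \<xi> stays under an existential: the state handed on by dependent
    choice is only the centre, the order and the radius of a ball.\<close>
  define step where "step i s s' \<longleftrightarrow> (case s of (x, N, e) \<Rightarrow> case s' of (x', N', e') \<Rightarrow>
      e' \<le> e / 2 \<and> Suc N \<le> N' \<and> (\<exists>\<xi>. \<forall>\<phi>. wbound N' e' (\<phi> - x') \<longrightarrow>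
        wbound N e (\<phi> - x) \<and> cmod (S \<xi> \<phi>) > real i * q \<xi> ^ i))"
    for i and s s' :: "schwartz \<times> nat \<times> real"
  have "\<exists>f. \<forall>i. (case f i of (x, N, e) \<Rightarrow> 0 < e) \<and> step i (f i) (f (Suc i))"
  proof (rule dependent_nat_choice)
    show "\<exists>s. case s :: schwartz \<times> nat \<times> real of (x, N, e) \<Rightarrow> 0 < e"
      by (rule exI[of _ "(0, 0, 1)"]) simp
    fix s :: "schwartz \<times> nat \<times> real" and i
    assume "case s of (x, N, e) \<Rightarrow> 0 < e"
    then obtain x N e where s: "s = (x, N, e)" and e: "e > 0" by (cases s) auto
    obtain x' N' e' \<xi> where *: "e' > 0" "e' \<le> e / 2" "Suc N \<le> N'"
      "\<forall>\<phi>. wbound N' e' (\<phi> - x') \<longrightarrow> wbound N e (\<phi> - x) \<and> cmod (S \<xi> \<phi>) > real i * q \<xi> ^ i"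
      using shrink[OF e] by blast
    show "\<exists>s'. (case s' of (x, N, e) \<Rightarrow> 0 < e) \<and> step i s s'"
      by (rule exI[of _ "(x', N', e')"]) (use * in \<open>auto simp: step_def s\<close>)
  qed
  then obtain f where f: "\<And>i. case f i of (x, N, e) \<Rightarrow> 0 < e"
    "\<And>i. step i (f i) (f (Suc i))"
    by (elim exE) (auto simp: all_conj_distrib)
  define x where "x i = fst (f i)" for i
  define N where "N i = fst (snd (f i))" for i
  define e where "e i = snd (snd (f i))" for i
  have f_eq: "f i = (x i, N i, e i)" for i by (simp add: x_def N_def e_def)
  have e_pos: "0 < e i" and e_half: "e (Suc i) \<le> e i / 2" and N_Suc: "Suc (N i) \<le> N (Suc i)"
    and ball_Suc: "wbound (N (Suc i)) (e (Suc i)) (\<phi> - x (Suc i)) \<Longrightarrow> wbound (N i) (e i) (\<phi> - x i)"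
    for i \<phi>
    using f(1)[of i] f(2)[of i] by (auto simp: f_eq step_def)
  have big: "\<exists>\<xi>. \<forall>\<phi>. wbound (N (Suc i)) (e (Suc i)) (\<phi> - x (Suc i)) \<longrightarrow>
      cmod (S \<xi> \<phi>) > real i * q \<xi> ^ i" for i
    using f(2)[of i] unfolding f_eq step_def by auto
  have nested: "wbound (N i) (e i) (\<phi> - x i)" if "wbound (N j) (e j) (\<phi> - x j)" "i \<le> j" for i j \<phi>
    using that(2,1) by (induction rule: dec_induct) (auto intro: ball_Suc)
  have in_ball: "wbound (N i) (e i) (x j - x i)" if "i \<le> j" for i j
    using nested[OF _ that, of "x j"] e_pos[of j] by (simp add: wbound_zero)
  have N_ge: "i \<le> N i" for i
  proof (induction i)
    case (Suc i)
    then show ?case using N_Suc[of i] by linarith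
  qed simp
  have e_le: "e i \<le> e 0 * (1 / 2) ^ i" for i
  proof (induction i)
    case (Suc i)
    then show ?case using e_half[of i] by simp
  qed simp
  obtain \<phi> where \<phi>: "\<And>k t. (\<lambda>n. sder k (x n) t) \<longlonglongrightarrow> sder k \<phi> t"
  proof (rule schwartz_complete[of x])
    fix M and d :: real assume d: "d > 0"
    have "(\<lambda>i. e 0 * (1 / 2) ^ i) \<longlonglongrightarrow> e 0 * 0" by (intro tendsto_intros LIMSEQ_realpow_zero) auto
    then have "\<forall>\<^sub>F i in sequentially. e 0 * (1 / 2) ^ i < d / 2"
      using d by (intro order_tendstoD) auto
    then obtain j where j: "\<And>i. i \<ge> j \<Longrightarrow> e 0 * (1 / 2) ^ i < d / 2"
      unfolding eventually_sequentially by blast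
    \<comment> \<open>Past j the radii are small, and past M the order is at least M because it
      grows in every step; so the centres are Cauchy for every seminorm.\<close>
    define i where "i = max j M"
    have ei: "e i \<le> d / 2" using j[of i] e_le[of i] by (simp add: i_def)
    have "wbound M d (x m - x n)" if "m \<ge> i" "n \<ge> i" for m n
    proof -
      have "wbound (N i) (e i + e i) ((x m - x i) - (x n - x i))"
        by (intro wbound_minus in_ball that)
      then show ?thesis
        using N_ge[of i] ei wbound_antimono[of "N i" "e i + e i" _ M d] by (simp add: i_def)
    qed
    then show "\<exists>K. \<forall>m\<ge>K. \<forall>n\<ge>K. wbound M d (x m - x n)" by blast
  qed blast
  have lim_in_ball: "wbound (N i) (e i) (\<phi> - x i)" for i
    unfolding wbound_def sder_minus
  proof (intro allI impI)
    fix k assume k: "k \<le> N i"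
    show "decay (N i) (e i) (\<lambda>t. sder k \<phi> t - sder k (x i) t)"
    proof (rule decay_limit)
      show "(\<lambda>n. sder k (x n) t - sder k (x i) t) \<longlonglongrightarrow> sder k \<phi> t - sder k (x i) t" for t
        by (intro tendsto_intros \<phi>)
      show "decay (N i) (e i) (\<lambda>t. sder k (x n) t - sder k (x i) t)" if "n \<ge> i" for n
        using in_ball[OF that] k by (simp add: wbound_def sder_minus)
    qed
  qed
  obtain k :: nat where k: "\<And>\<xi>. cmod (S \<xi> \<phi>) \<le> real k * q \<xi> ^ k" using bd by blast
  \<comment> \<open>The limit lies in all balls, in particular in ball k + 1, on which the bound
    with this very k is violated.\<close>
  show False using big[of k] lim_in_ball k by (meson not_less)
qed

section \<open>Decay of solutions of first-order equations\<close>

lemma antiderivative_ex: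
  fixes f :: "real \<Rightarrow> complex"
  assumes "\<And>t. isCont f t"
  obtains w where "\<And>t. (w has_vector_derivative f t) (at t)"
  using einterval_antiderivative[of "-\<infinity>" "\<infinity>" f] assms by auto

text \<open>The mean value inequality, used in place of integrals: \<open>h\<close> is an explicit
  primitive of a majorant of w', and its increments do the work of the integral of that majorant.
  Below, \<open>h\<close> is a multiple of arctan or of an exponential.\<close>

lemma norm_increment_le:
  fixes w :: "real \<Rightarrow> complex"
  assumes "s \<le> t"
    and w: "\<And>x. (w has_vector_derivative w' x) (at x)"
    and h: "\<And>x. (h has_vector_derivative h' x) (at x)"
    and le: "\<And>x. s < x \<Longrightarrow> x < t \<Longrightarrow> cmod (w' x) \<le> h' x"
  shows "cmod (w t - w s) \<le> h t - h s"
proof (cases "s = t")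
  case False
  have "continuous_on {s..t} w" "continuous_on {s..t} h"
    using has_vector_derivative_continuous[OF w] has_vector_derivative_continuous[OF h]
    by (auto intro: continuous_at_imp_continuous_on)
  with False assms show ?thesis by (intro differentiable_bound_general[of s t w h w' h']) auto
qed simp

lemma norm_diff_limit_le:
  fixes w :: "real \<Rightarrow> complex"
  assumes "\<And>s. s \<le> t \<Longrightarrow> cmod (w t - w s) \<le> h t - h s"
    and "(w \<longlongrightarrow> W) at_bot" "(h \<longlongrightarrow> H) at_bot"
  shows "cmod (w t - W) \<le> h t - H"
proof (rule tendsto_le)
  show "((\<lambda>s. h t - h s) \<longlongrightarrow> h t - H) at_bot" by (intro tendsto_intros assms)
  show "((\<lambda>s. cmod (w t - w s)) \<longlongrightarrow> cmod (w t - W)) at_bot" by (intro tendsto_intros assms)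
  show "\<forall>\<^sub>F s in at_bot. cmod (w t - w s) \<le> h t - h s"
    using eventually_le_at_bot[of t] by eventually_elim (rule assms(1))
qed simp

text \<open>Increments of \<open>h\<close> become small towards minus infinity, so \<open>w\<close>
  is Cauchy along -n; the increment bound then passes to the limit and controls all real t, not only
  the sequence.\<close>

lemma limit_at_bot_ex:
  fixes w :: "real \<Rightarrow> complex"
  assumes le: "\<And>s t. s \<le> t \<Longrightarrow> cmod (w t - w s) \<le> h t - h s"
    and h: "(h \<longlongrightarrow> H) at_bot"
  obtains W where "(w \<longlongrightarrow> W) at_bot"
proof -
  have to_bot: "filterlim (\<lambda>n. - real n) at_bot sequentially"
    by (simp add: filterlim_uminus_at_bot filterlim_real_sequentially)
  have h_seq: "(\<lambda>n. h (- real n)) \<longlonglongrightarrow> H" using filterlim_compose[OF h to_bot] by simp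
  have "Cauchy (\<lambda>n. w (- real n))"
  proof (rule metric_CauchyI)
    fix e :: real assume "e > 0"
    then obtain M where M: "\<And>m n. m \<ge> M \<Longrightarrow> n \<ge> M \<Longrightarrow> dist (h (- real m)) (h (- real n)) < e"
      using metric_CauchyD[OF LIMSEQ_imp_Cauchy[OF h_seq]] by blast
    have dist_le: "dist (w (- real m)) (w (- real n)) \<le> dist (h (- real m)) (h (- real n))" for m n
      using le[of "- real m" "- real n"] le[of "- real n" "- real m"]
      by (cases "m \<le> n") (auto simp: dist_norm norm_minus_commute)
    show "\<exists>M. \<forall>m\<ge>M. \<forall>n\<ge>M. dist (w (- real m)) (w (- real n)) < e"
      using le_less_trans[OF dist_le M] by blast
  qed
  then obtain W where W: "(\<lambda>n. w (- real n)) \<longlonglongrightarrow> W"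
    by (auto simp: Cauchy_convergent_iff convergent_def)
  have "cmod (w t - W) \<le> h t - H" for t
  proof (rule tendsto_le)
    show "(\<lambda>n. h t - h (- real n)) \<longlonglongrightarrow> h t - H" by (intro tendsto_intros h_seq)
    show "(\<lambda>n. cmod (w t - w (- real n))) \<longlonglongrightarrow> cmod (w t - W)" by (intro tendsto_intros W)
    have "\<forall>\<^sub>F n in sequentially. - real n \<le> t"
      using to_bot by (simp add: filterlim_at_bot)
    then show "\<forall>\<^sub>F n in sequentially. cmod (w t - w (- real n)) \<le> h t - h (- real n)"
      by eventually_elim (rule le)
  qed simp
  moreover have "((\<lambda>t. h t - H) \<longlongrightarrow> H - H) at_bot" by (intro tendsto_intros h)
  ultimately have "((\<lambda>t. w t - W) \<longlongrightarrow> 0) at_bot"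
    by (subst Lim_null_comparison[where g = "\<lambda>t. h t - H"]) simp_all
  then have "(w \<longlongrightarrow> W) at_bot" by (simp add: LIM_zero_iff)
  with that show ?thesis .
qed

section \<open>Reflection, and primitives of rapidly decreasing functions\<close>

lemma has_vector_derivative_reflect:
  assumes "\<And>t::real. (w has_vector_derivative f t) (at t)"
  shows "((\<lambda>t. w (- t)) has_vector_derivative - f (- t)) (at t)"
proof -
  have "((\<lambda>t::real. - t) has_vector_derivative - 1) (at t)" by (auto intro!: derivative_eq_intros)
  from vector_diff_chain_at[OF this assms] show ?thesis by (simp add: o_def)
qed

lemma decay_reflect: "decay N r (\<lambda>t. f (- t)) \<longleftrightarrow> decay N r f"
  unfolding decay_def by (metis abs_minus_cancel minus_minus)

lemma decay_uminus: "decay N r (\<lambda>t. - f t) \<longleftrightarrow> decay N r f"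
  by (simp add: decay_def)

lemma one_plus_square_le: "1 + x\<^sup>2 \<le> (1 + \<bar>x\<bar>)\<^sup>2" for x :: real
  by (simp add: power2_sum)

text \<open>Two powers of the weight are spent on the integrable factor 1 / (1 + x^2), whose
  primitive is arctan; the other N are moved from x to t, which is where |t| \<le> |x|
  enters.\<close>

lemma decay_shift_le:
  assumes "decay (N + 2) r f" "\<bar>t\<bar> \<le> \<bar>x\<bar>"
  shows "cmod (f x) \<le> r / (1 + \<bar>t\<bar>) ^ N * inverse (1 + x\<^sup>2)"
proof -
  have "((1 + \<bar>t\<bar>) ^ N * (1 + x\<^sup>2)) * cmod (f x) \<le> ((1 + \<bar>x\<bar>) ^ N * (1 + \<bar>x\<bar>)\<^sup>2) * cmod (f x)"
    using assms(2) by (intro mult_right_mono mult_mono power_mono one_plus_square_le) auto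
  also have "\<dots> \<le> r" using decayD[OF assms(1), of x] by (simp only: power_add)
  finally have "((1 + \<bar>t\<bar>) ^ N * (1 + x\<^sup>2)) * cmod (f x) \<le> r" .
  moreover have "0 < (1 + \<bar>t\<bar>) ^ N * (1 + x\<^sup>2)" by (intro mult_pos_pos zero_less_power) (auto simp: add_pos_nonneg)
  ultimately have "cmod (f x) \<le> r / ((1 + \<bar>t\<bar>) ^ N * (1 + x\<^sup>2))"
    by (simp add: pos_le_divide_eq mult.commute)
  then show ?thesis by (simp add: divide_inverse)
qed

lemma arctan_has_vector_derivative:
  "((\<lambda>x. c * arctan x) has_vector_derivative c * inverse (1 + x\<^sup>2)) (at x)"
  by (auto intro!: derivative_eq_intros simp: has_real_derivative_iff_has_vector_derivative[symmetric])

lemma arctan_tendsto_at_bot: "((\<lambda>x. c * arctan x) \<longlongrightarrow> c * (- (pi / 2))) at_bot"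
  by (intro tendsto_intros tendsto_arctan_at_bot)

lemma primitive_tendsto_at_bot:
  assumes w: "\<And>t. (w has_vector_derivative f t) (at t)" and f: "decay 2 r f"
  obtains W where "(w \<longlongrightarrow> W) at_bot"
proof (rule limit_at_bot_ex)
  show "cmod (w t - w s) \<le> r * arctan t - r * arctan s" if "s \<le> t" for s t
    using decay_shift_le[of 0 r f 0] f
    by (intro norm_increment_le[OF that w arctan_has_vector_derivative]) (simp add: numeral_2_eq_2)
qed (use arctan_tendsto_at_bot in auto)

lemma primitive_tendsto_at_top:
  assumes w: "\<And>t. (w has_vector_derivative f t) (at t)" and f: "decay 2 r f"
  obtains W where "(w \<longlongrightarrow> W) at_top"
proof -
  have "decay 2 r (\<lambda>t. - f (- t))" using f by (simp add: decay_uminus decay_reflect)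
  from primitive_tendsto_at_bot[OF has_vector_derivative_reflect[OF w] this]
  obtain W where "((\<lambda>t. w (- t)) \<longlongrightarrow> W) at_bot" by blast
  then have "(w \<longlongrightarrow> W) at_top" by (simp add: filterlim_at_bot_mirror)
  then show ?thesis by (rule that)
qed

lemma primitive_limit_le:
  assumes w: "\<And>t. (w has_vector_derivative f t) (at t)" and f: "decay 2 r f"
    and "(w \<longlongrightarrow> 0) at_bot" "(w \<longlongrightarrow> W) at_top"
  shows "cmod W \<le> pi * r"
proof -
  have r: "0 \<le> r" using decay_nonneg[OF f] .
  have "cmod (w t - 0) \<le> r * arctan t - r * (- (pi / 2))" for t
  proof (rule norm_diff_limit_le[OF _ assms(3) arctan_tendsto_at_bot])
    show "cmod (w t - w s) \<le> r * arctan t - r * arctan s" if "s \<le> t" for s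
      using decay_shift_le[of 0 r f 0] f
      by (intro norm_increment_le[OF that w arctan_has_vector_derivative]) (simp add: numeral_2_eq_2)
  qed
  moreover have "r * arctan t - r * (- (pi / 2)) \<le> r * pi" for t
    using mult_left_mono[OF less_imp_le[OF arctan_ubound[of t]] r] by (simp add: field_simps)
  ultimately have "cmod (w t) \<le> pi * r" for t by (metis diff_zero mult.commute order_trans)
  then show ?thesis
    using assms(4) by (intro tendsto_upperbound[OF tendsto_norm[OF assms(4)]] always_eventually) auto
qed

text \<open>For t \<le> 0 the primitive is estimated from minus infinity, and every x \<le> t
  satisfies |t| \<le> |x|. The constant pi is the total increase of arctan.\<close>

lemma primitive_decay_nonpos:
  assumes w: "\<And>t. (w has_vector_derivative f t) (at t)" and f: "decay (N + 2) r f"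
    and "(w \<longlongrightarrow> 0) at_bot" "t \<le> 0"
  shows "(1 + \<bar>t\<bar>) ^ N * cmod (w t) \<le> pi * r"
proof -
  define c where "c = r / (1 + \<bar>t\<bar>) ^ N"
  have c: "0 \<le> c" using decay_nonneg[OF f] by (simp add: c_def)
  have "cmod (w t - 0) \<le> c * arctan t - c * (- (pi / 2))"
  proof (rule norm_diff_limit_le[OF _ assms(3) arctan_tendsto_at_bot])
    show "cmod (w t - w s) \<le> c * arctan t - c * arctan s" if "s \<le> t" for s
      unfolding c_def using assms(4)
      by (intro norm_increment_le[OF that w arctan_has_vector_derivative] decay_shift_le[OF f]) auto
  qed
  also have "\<dots> \<le> c * pi"
    using mult_left_mono[OF less_imp_le[OF arctan_ubound[of t]] c] by (simp add: field_simps)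
  finally have "(1 + \<bar>t\<bar>) ^ N * cmod (w t) \<le> (1 + \<bar>t\<bar>) ^ N * (c * pi)"
    by (intro mult_left_mono) auto
  also have "\<dots> = pi * r" by (simp add: c_def)
  finally show ?thesis .
qed

text \<open>Starting from minus infinity, the path to a point t > 0 would cross the region near 0
  where the weight gives nothing. There the estimate starts from plus infinity instead, by
  reflection; this is why \<open>w\<close> has to vanish at both ends.\<close>

lemma primitive_decay:
  assumes w: "\<And>t. (w has_vector_derivative f t) (at t)" and f: "decay (N + 2) r f"
    and bot: "(w \<longlongrightarrow> 0) at_bot" and top: "(w \<longlongrightarrow> 0) at_top"
  shows "decay N (pi * r) w"
proof (rule decayI)
  fix t :: real
  show "(1 + \<bar>t\<bar>) ^ N * cmod (w t) \<le> pi * r"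
  proof (cases "t \<le> 0")
    case True
    then show ?thesis by (rule primitive_decay_nonpos[OF w f bot])
  next
    case False
    have "decay (N + 2) r (\<lambda>t. - f (- t))" using f by (simp add: decay_uminus decay_reflect)
    moreover have "((\<lambda>t. w (- t)) \<longlongrightarrow> 0) at_bot" using top by (simp add: filterlim_at_bot_mirror)
    ultimately show ?thesis
      using primitive_decay_nonpos[OF has_vector_derivative_reflect[OF w], of N r "- t"] False by simp
  qed
qed

section \<open>Exponential kernels, for roots off the imaginary axis\<close>

lemma power_le_fact_mult_exp: "y ^ n \<le> fact n * exp y" if "0 \<le> y" for y :: real
proof -
  have "(\<Sum>k\<in>{n}. inverse (fact k) *\<^sub>R y ^ k) \<le> suminf (\<lambda>k. inverse (fact k) *\<^sub>R y ^ k)"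
    using that by (intro sum_le_suminf summable_exp_generic) auto
  then have "inverse (fact n) * y ^ n \<le> exp y" by (simp add: exp_def)
  then show ?thesis by (simp add: field_simps)
qed

text \<open>At the cost of 2 (1 + 1/a) one replaces 1 + u by y = (1 + a u) / 2 and uses y^N \<le> N!
  exp y. The rate a/2 is half of the decay rate a of the kernel, so the other half is left for
  integration. \<open>4 ^ Suc N\<close> absorbs 2^N exp(1/2).\<close>

lemma one_plus_power_le_exp:
  fixes a u :: real
  assumes "a > 0" "u \<ge> 0"
  shows "(1 + u) ^ N \<le> 4 ^ Suc N * fact N * (1 + 1 / a) ^ N * exp (a / 2 * u)"
proof -
  have "(1 + u) ^ N \<le> (2 * (1 + 1 / a) * ((1 + a * u) / 2)) ^ N"
  proof (rule power_mono)
    have "2 * (1 + 1 / a) * ((1 + a * u) / 2) = 1 + u + a * u + 1 / a"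
      using assms by (simp add: field_simps)
    then show "1 + u \<le> 2 * (1 + 1 / a) * ((1 + a * u) / 2)" using assms by simp
  qed (use assms in auto)
  also have "\<dots> = (2 * (1 + 1 / a)) ^ N * ((1 + a * u) / 2) ^ N" by (rule power_mult_distrib)
  also have "\<dots> \<le> (2 * (1 + 1 / a)) ^ N * (fact N * exp ((1 + a * u) / 2))"
    using assms by (intro mult_left_mono power_le_fact_mult_exp) auto
  also have "exp ((1 + a * u) / 2) = exp (1 / 2) * exp (a / 2 * u)"
    by (simp add: exp_add[symmetric] add_divide_distrib)
  also have "(2 * (1 + 1 / a)) ^ N * (fact N * (exp (1 / 2) * exp (a / 2 * u)))
      = (2 ^ N * exp (1 / 2)) * (fact N * (1 + 1 / a) ^ N * exp (a / 2 * u))"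
    by (simp only: power_mult_distrib mult_ac)
  also have "\<dots> \<le> (4 ^ N * 4) * (fact N * (1 + 1 / a) ^ N * exp (a / 2 * u))"
  proof (intro mult_right_mono mult_mono power_mono)
    have "exp (1 / 2 :: real) \<le> exp 1" by simp
    also have "\<dots> \<le> 3" by (rule exp_le)
    finally show "exp (1 / 2 :: real) \<le> 4" by simp
  qed (use assms in auto)
  finally show ?thesis by (simp add: mult_ac)
qed

lemma exp_has_vector_derivative:
  fixes l :: complex
  shows "((\<lambda>t. exp (l * of_real t)) has_vector_derivative l * exp (l * of_real t)) (at t)"
proof -
  have "((\<lambda>z. exp (l * z)) has_field_derivative l * exp (l * of_real t)) (at (of_real t))"
    by (auto intro!: derivative_eq_intros)
  then show ?thesis by (rule has_vector_derivative_real_field)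
qed

lemma integrating_factor:
  fixes l :: complex and w :: "real \<Rightarrow> complex"
  assumes "(w has_vector_derivative exp (l * of_real t) * f) (at t)"
  shows "((\<lambda>t. exp (- l * of_real t) * w t) has_vector_derivative
    f - l * (exp (- l * of_real t) * w t)) (at t)"
proof -
  have "((\<lambda>t. exp (- l * of_real t) * w t) has_vector_derivative
    exp (- l * of_real t) * (exp (l * of_real t) * f) + - l * exp (- l * of_real t) * w t) (at t)"
    by (rule has_vector_derivative_mult[OF exp_has_vector_derivative assms])
  moreover have "exp (- l * of_real t) * (exp (l * of_real t) * f) = f"
    by (simp add: mult.assoc[symmetric] exp_minus)
  ultimately show ?thesis by (simp only: mult_minus_left add_uminus_conv_diff mult.assoc)
qed

lemma exp_has_vector_derivative_real:
  "c \<noteq> 0 \<Longrightarrow> ((\<lambda>x. k / c * exp (c * x)) has_vector_derivative k * exp (c * x)) (at x)"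
  for c k :: real
  by (auto intro!: derivative_eq_intros simp: has_real_derivative_iff_has_vector_derivative[symmetric])

lemma exp_tendsto_at_bot:
  fixes c k :: real
  assumes "c > 0"
  shows "((\<lambda>x. k * exp (c * x)) \<longlongrightarrow> k * 0) at_bot"
  using assms by (intro tendsto_mult tendsto_const filterlim_compose[OF exp_at_bot]
      filterlim_tendsto_pos_mult_at_bot[OF tendsto_const _ filterlim_ident])

text \<open>The solution is exp(-l t) times the integral of exp(l x) f(x) over x < t, with kernel
  exp(-l (t - x)). Half of its decay rate pays for moving the weight from t to x; integrating the
  other half yields 2 / Re l, whence one more power of 1 + 1 / Re l. The bounds are quantified
  inside the conclusion because one \<psi> has to serve all \<open>N\<close> and
  \<open>r\<close>.\<close>

lemma solve_ode_Re_pos: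
  assumes f: "\<And>t. isCont f t" "decay 0 r0 f" and l: "Re l > 0"
  obtains \<psi> where "\<And>t. (\<psi> has_vector_derivative f t - l * \<psi> t) (at t)"
    and "\<And>N r. decay N r f \<Longrightarrow> decay N (2 * 4 ^ Suc N * fact N * (1 + 1 / Re l) ^ Suc N * r) \<psi>"
proof -
  let ?a = "Re l"
  have "isCont (\<lambda>t. exp (l * of_real t) * f t) t" for t
    by (intro continuous_intros f)
  then obtain w0 where w0: "\<And>t. (w0 has_vector_derivative exp (l * of_real t) * f t) (at t)"
    using antiderivative_ex by blast
  have "cmod (w0 t - w0 s) \<le> r0 / ?a * exp (?a * t) - r0 / ?a * exp (?a * s)" if "s \<le> t" for s t
  proof (rule norm_increment_le[OF that w0 exp_has_vector_derivative_real])
    show "cmod (exp (l * of_real x) * f x) \<le> r0 * exp (?a * x)" for x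
      using decayD[OF f(2), of x] by (simp add: norm_mult)
  qed (use l in auto)
  then obtain W where W: "(w0 \<longlongrightarrow> W) at_bot"
    using limit_at_bot_ex[OF _ exp_tendsto_at_bot[OF l]] by blast
  define w where "w t = w0 t - W" for t
  have w: "(w has_vector_derivative exp (l * of_real t) * f t) (at t)" for t
    unfolding w_def using has_vector_derivative_diff[OF w0 has_vector_derivative_const] by simp
  have w_lim: "(w \<longlongrightarrow> 0) at_bot"
    unfolding w_def using W by (simp add: LIM_zero_iff)
  show ?thesis
  proof (rule that)
    show "((\<lambda>t. exp (- l * of_real t) * w t) has_vector_derivative
        f t - l * (exp (- l * of_real t) * w t)) (at t)" for t
      by (rule integrating_factor[OF w])
    fix N r assume fN: "decay N r f"
    let ?C = "4 ^ Suc N * fact N * (1 + 1 / ?a) ^ N"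
    show "decay N (2 * 4 ^ Suc N * fact N * (1 + 1 / ?a) ^ Suc N * r) (\<lambda>t. exp (- l * of_real t) * w t)"
    proof (rule decayI)
      fix t :: real
      \<comment> \<open>With t fixed and a = Re l, exp(a x) exp(a (t - x) / 2) = exp(a t / 2) exp(a
        x / 2), so the integrand is at most \<open>K\<close> exp(a x / 2), whose primitive is
        explicit.\<close>
      define K where "K = r / (1 + \<bar>t\<bar>) ^ N * ?C * exp (?a / 2 * t)"
      have r: "0 \<le> r" by (rule decay_nonneg[OF fN])
      have nz: "1 + \<bar>t\<bar> \<noteq> 0" by linarith
      have f_le: "cmod (exp (l * of_real x) * f x) \<le> K * exp (?a / 2 * x)" if "x < t" for x
      proof -
        have "(1 + \<bar>t\<bar>) ^ N * cmod (f x) \<le> ((1 + \<bar>x\<bar>) * (1 + (t - x))) ^ N * cmod (f x)"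
        proof (intro mult_right_mono power_mono)
          have "1 + \<bar>t\<bar> \<le> 1 + \<bar>x\<bar> + (t - x)" using that by linarith
          also have "\<dots> \<le> 1 + \<bar>x\<bar> + (t - x) + \<bar>x\<bar> * (t - x)" using that by simp
          also have "\<dots> = (1 + \<bar>x\<bar>) * (1 + (t - x))" by (simp add: algebra_simps)
          finally show "1 + \<bar>t\<bar> \<le> (1 + \<bar>x\<bar>) * (1 + (t - x))" .
        qed auto
        also have "\<dots> = (1 + (t - x)) ^ N * ((1 + \<bar>x\<bar>) ^ N * cmod (f x))"
          by (simp add: power_mult_distrib mult_ac)
        also have "\<dots> \<le> (?C * exp (?a / 2 * (t - x))) * r"
          using that l r
          by (intro mult_mono one_plus_power_le_exp decayD[OF fN]) auto
        finally have "cmod (f x) \<le> ?C * exp (?a / 2 * (t - x)) * r / (1 + \<bar>t\<bar>) ^ N"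
          by (simp add: pos_le_divide_eq mult.commute)
        then have "exp (?a * x) * cmod (f x) \<le> exp (?a * x) * (?C * exp (?a / 2 * (t - x)) * r / (1 + \<bar>t\<bar>) ^ N)"
          by (intro mult_left_mono) auto
        also have "\<dots> = r / (1 + \<bar>t\<bar>) ^ N * ?C * (exp (?a * x) * exp (?a / 2 * (t - x)))"
          by simp
        also have "exp (?a * x) * exp (?a / 2 * (t - x)) = exp (?a / 2 * t) * exp (?a / 2 * x)"
          by (simp add: exp_add[symmetric] field_simps)
        finally show ?thesis by (simp add: K_def norm_mult mult_ac)
      qed
      have "cmod (w t - w s) \<le> K / (?a / 2) * exp (?a / 2 * t) - K / (?a / 2) * exp (?a / 2 * s)"
        if "s \<le> t" for s
        by (rule norm_increment_le[OF that w exp_has_vector_derivative_real]) (use l f_le in auto)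
      from norm_diff_limit_le[OF this w_lim exp_tendsto_at_bot] l
      have "cmod (w t) \<le> K / (?a / 2) * exp (?a / 2 * t)" by simp
      then have "(1 + \<bar>t\<bar>) ^ N * cmod (exp (- l * of_real t) * w t)
          \<le> (1 + \<bar>t\<bar>) ^ N * (exp (- ?a * t) * (K / (?a / 2) * exp (?a / 2 * t)))"
        unfolding norm_mult by (intro mult_mono) auto
      also have "\<dots> = (1 + \<bar>t\<bar>) ^ N * (r / (1 + \<bar>t\<bar>) ^ N) * ?C * (2 / ?a) *
          (exp (- ?a * t) * (exp (?a / 2 * t) * exp (?a / 2 * t)))"
        using nz by (simp add: K_def mult_ac)
      also have "(1 + \<bar>t\<bar>) ^ N * (r / (1 + \<bar>t\<bar>) ^ N) = r"
        using nz by simp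
      also have "exp (- ?a * t) * (exp (?a / 2 * t) * exp (?a / 2 * t)) = 1"
        by (simp add: exp_add[symmetric])
      also have "r * ?C * (2 / ?a) * 1 \<le> r * ?C * (2 * (1 + 1 / ?a))"
        unfolding mult_1_right using r l by (intro mult_left_mono mult_nonneg_nonneg) auto
      also have "\<dots> = 2 * 4 ^ Suc N * fact N * (1 + 1 / ?a) ^ Suc N * r" by simp
      finally show "(1 + \<bar>t\<bar>) ^ N * cmod (exp (- l * of_real t) * w t)
          \<le> 2 * 4 ^ Suc N * fact N * (1 + 1 / ?a) ^ Suc N * r" .
    qed
  qed
qed

text \<open>For Re l < 0 the substitution of -t for t replaces l by -l and f(t) by -f(-t), which
  amounts to integrating from plus infinity.\<close>

lemma solve_ode_Re_nonzero:
  assumes f: "\<And>t. isCont f t" "decay 0 r0 f" and l: "Re l \<noteq> 0"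
  obtains \<psi> where "\<And>t. (\<psi> has_vector_derivative f t - l * \<psi> t) (at t)"
    and "\<And>N r. decay N r f \<Longrightarrow> decay N (2 * 4 ^ Suc N * fact N * (1 + 1 / \<bar>Re l\<bar>) ^ Suc N * r) \<psi>"
proof (cases "Re l > 0")
  case True
  then show ?thesis using solve_ode_Re_pos[OF f True] that by auto
next
  case False
  have "isCont (\<lambda>t. - f (- t)) t" for t
    using f(1)[of "- t"] by (intro continuous_intros isCont_o2[of t uminus f]) auto
  moreover have "decay 0 r0 (\<lambda>t. - f (- t))" using f(2) by (simp add: decay_uminus decay_reflect)
  moreover have "Re (- l) > 0" using False l by simp
  ultimately obtain \<psi> where \<psi>: "\<And>t. (\<psi> has_vector_derivative - f (- t) - - l * \<psi> t) (at t)"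
    "\<And>N r. decay N r (\<lambda>t. - f (- t)) \<Longrightarrow>
      decay N (2 * 4 ^ Suc N * fact N * (1 + 1 / Re (- l)) ^ Suc N * r) \<psi>"
    using solve_ode_Re_pos[of "\<lambda>t. - f (- t)" r0 "- l"] by blast
  show ?thesis
  proof (rule that)
    show "((\<lambda>t. \<psi> (- t)) has_vector_derivative f t - l * \<psi> (- t)) (at t)" for t
      using has_vector_derivative_reflect[OF \<psi>(1), of t] by simp
    show "decay N (2 * 4 ^ Suc N * fact N * (1 + 1 / \<bar>Re l\<bar>) ^ Suc N * r) (\<lambda>t. \<psi> (- t))"
      if "decay N r f" for N r
      using \<psi>(2)[of N r] that False by (simp add: decay_uminus decay_reflect)
  qed
qed

section \<open>Left inverses of first-order operators\<close>

lemma isCont_sder: "isCont (sder k \<phi>) t"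
  using has_vector_derivative_continuous[OF sder_has_vector_derivative] .

lemma sder_decay_ex: "\<exists>C. decay N C (sder k \<phi>)"
  using Rep_schwartz[of \<phi>] by (simp add: rapidly_decreasing_iff_decay)

lemma sder_ode:
  assumes "schwartz_deriv \<psi> + schwartz_scale l \<psi> = \<phi>"
  shows "sder (Suc k) \<psi> = (\<lambda>t. sder k \<phi> t - l * sder k \<psi> t)"
  using assms by (auto simp: sder_add sder_scale sder_deriv)

text \<open>The equation expresses each derivative of f through the previous one and a derivative of
  \<phi>. Smoothness and decay of all derivatives therefore follow once f itself decays.\<close>

lemma schwartz_solution_of_ode:
  assumes ode: "\<And>t. (f has_vector_derivative sder 0 \<phi> t - l * f t) (at t)"
    and decay: "\<And>N. \<exists>C. decay N C f"
  obtains \<psi> where "sder 0 \<psi> = f" "schwartz_deriv \<psi> + schwartz_scale l \<psi> = \<phi>"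
proof -
  define F where "F = rec_nat f (\<lambda>k Fk t. sder k \<phi> t - l * Fk t)"
  have F0: "F 0 = f" and F_Suc: "F (Suc k) = (\<lambda>t. sder k \<phi> t - l * F k t)" for k
    by (simp_all add: F_def)
  have deriv: "(F k has_vector_derivative F (Suc k) t) (at t)" for k t
  proof (induction k arbitrary: t)
    case 0
    then show ?case using ode by (simp add: F0 F_Suc)
  next
    case (Suc k)
    show ?case
      unfolding F_Suc[of k] F_Suc[of "Suc k"]
      by (intro has_vector_derivative_diff has_vector_derivative_mult_right sder_has_vector_derivative
          Suc.IH[unfolded F_Suc])
  qed
  have decay_F: "\<exists>C. decay N C (F k)" for N k
  proof (induction k)
    case 0
    then show ?case using decay by (simp add: F0)
  next
    case (Suc k)
    then obtain A where A: "decay N A (F k)" by blast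
    obtain B where B: "decay N B (sder k \<phi>)" using sder_decay_ex by blast
    from decay_add[OF B decay_mult[OF A, of "\<lambda>_. - l" "cmod l"]]
    show ?case by (auto simp: F_Suc)
  qed
  obtain \<psi> where \<psi>: "\<And>k. sder k \<psi> = F k" using schwartz_of_tower[of F, OF deriv decay_F] by blast
  show ?thesis
  proof (rule that)
    show "sder 0 \<psi> = f" using \<psi>[of 0] by (simp add: F0)
    show "schwartz_deriv \<psi> + schwartz_scale l \<psi> = \<phi>"
      using \<psi>[of 1] \<psi>[of 0] by (intro schwartz_eqI) (simp add: sder_add sder_scale sder_deriv F_Suc)
  qed
qed

lemma wbound_imp_decay: "wbound N r \<phi> \<Longrightarrow> M \<le> N \<Longrightarrow> decay M r (sder 0 \<phi>)"
  unfolding wbound_def by (meson decay_antimono le0 order_refl)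

text \<open>Derivatives of \<psi> are eliminated through the equation, each at the cost of a factor
  1 + |l|; only \<psi> itself has to be estimated by integration.\<close>

lemma wbound_of_ode:
  assumes ode: "schwartz_deriv \<psi> + schwartz_scale l \<psi> = \<phi>"
    and \<psi>: "decay N R (sder 0 \<psi>)" and \<phi>: "wbound N r \<phi>"
  shows "wbound N ((1 + cmod l) ^ N * (R + r)) \<psi>"
proof -
  have R: "0 \<le> R" and r: "0 \<le> r" using decay_nonneg[OF \<psi>] wbound_nonneg[OF \<phi>] .
  have "decay N ((1 + cmod l) ^ k * (R + r)) (sder k \<psi>)" if "k \<le> N" for k
    using that
  proof (induction k)
    case 0
    then show ?case using \<psi> r by (auto intro: decay_antimono)
  next
    case (Suc k)
    have "1 * (R + r) \<le> (1 + cmod l) ^ k * (R + r)"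
      using R r by (intro mult_right_mono one_le_power) auto
    then have le: "r + cmod (- l) * ((1 + cmod l) ^ k * (R + r)) \<le> (1 + cmod l) ^ Suc k * (R + r)"
      using R by (simp add: distrib_right mult.assoc)
    have "decay N (r + cmod (- l) * ((1 + cmod l) ^ k * (R + r))) (\<lambda>t. sder k \<phi> t + - l * sder k \<psi> t)"
      using \<phi> Suc by (intro decay_add decay_mult) (auto simp: wbound_def)
    from decay_antimono[OF this order_refl le] show ?case
      unfolding sder_ode[OF ode] by simp
  qed
  moreover have "(1 + cmod l) ^ k * (R + r) \<le> (1 + cmod l) ^ N * (R + r)" if "k \<le> N" for k
    using that R r by (intro mult_right_mono power_increasing) auto
  ultimately show ?thesis unfolding wbound_def by (meson decay_antimono order_refl)
qed

section \<open>The Gaussian and its modulations\<close>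

lemma norm_poly_le:
  fixes p :: "complex poly"
  shows "\<exists>C n. 0 \<le> C \<and> (\<forall>z. cmod (poly p z) \<le> C * (1 + cmod z) ^ n)"
proof (induction p)
  case (pCons a p)
  then obtain C n where C: "0 \<le> C" "\<And>z. cmod (poly p z) \<le> C * (1 + cmod z) ^ n" by blast
  have "cmod (poly (pCons a p) z) \<le> (cmod a + C) * (1 + cmod z) ^ Suc n" for z
  proof -
    have "cmod (poly (pCons a p) z) \<le> cmod a + cmod z * cmod (poly p z)"
      using norm_triangle_ineq[of a "z * poly p z"] by (simp add: norm_mult)
    also have "\<dots> \<le> cmod a * (1 + cmod z) ^ Suc n + (1 + cmod z) * (C * (1 + cmod z) ^ n)"
    proof (intro add_mono mult_mono C)
      have "1 \<le> (1 + cmod z) ^ Suc n" by (rule one_le_power) simp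
      from mult_left_mono[OF this, of "cmod a"] show "cmod a \<le> cmod a * (1 + cmod z) ^ Suc n" by simp
    qed auto
    finally show ?thesis by (simp add: algebra_simps)
  qed
  with C(1) show ?case by (intro exI[of _ "cmod a + C"] exI[of _ "Suc n"]) auto
qed (auto intro: exI[of _ 0])

lemma gaussian_ex:
  obtains g where "\<And>t. sder 0 g t = exp (- (of_real t)\<^sup>2)"
proof -
  \<comment> \<open>The derivative of p(t) exp(-t^2) is (p' - 2 t p) exp(-t^2); the resulting
    polynomials are the Hermite polynomials up to sign.\<close>
  define q :: "nat \<Rightarrow> complex poly" where "q = rec_nat 1 (\<lambda>_ p. pderiv p - [:0, 2:] * p)"
  have q0: "q 0 = 1" and q_Suc: "q (Suc k) = pderiv (q k) - [:0, 2:] * q k" for k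
    by (simp_all add: q_def)
  define F :: "nat \<Rightarrow> real \<Rightarrow> complex" where
    "F k t = poly (q k) (of_real t) * exp (- (of_real t)\<^sup>2)" for k t
  have deriv: "(F k has_vector_derivative F (Suc k) t) (at t)" for k t
    unfolding F_def
    by (rule has_vector_derivative_real_field)
      (auto intro!: derivative_eq_intros simp: q_Suc algebra_simps)
  have "\<exists>C. decay N C (F k)" for N k
  proof -
    obtain C n where C: "0 \<le> C" "\<And>z. cmod (poly (q k) z) \<le> C * (1 + cmod z) ^ n"
      using norm_poly_le by blast
    have "decay N (C * (fact (N + n) * exp 2)) (F k)"
    proof (rule decayI)
      fix t :: real
      have "(1 + \<bar>t\<bar>) ^ N * cmod (F k t) = (1 + \<bar>t\<bar>) ^ N * (cmod (poly (q k) (of_real t)) * exp (- t\<^sup>2))"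
        by (simp add: F_def norm_mult power2_eq_square)
      also have "\<dots> \<le> (1 + \<bar>t\<bar>) ^ N * (C * (1 + \<bar>t\<bar>) ^ n * exp (- t\<^sup>2))"
        using C(2)[of "of_real t"] by (intro mult_left_mono mult_right_mono) auto
      also have "\<dots> = C * ((1 + \<bar>t\<bar>) ^ (N + n) * exp (- t\<^sup>2))" by (simp add: power_add)
      also have "\<dots> \<le> C * (fact (N + n) * exp (1 + \<bar>t\<bar>) * exp (- t\<^sup>2))"
        using C(1) by (intro mult_left_mono mult_right_mono power_le_fact_mult_exp) auto
      also have "\<dots> = C * (fact (N + n) * exp (1 + \<bar>t\<bar> - t\<^sup>2))" by (simp add: exp_diff exp_minus field_simps)
      also have "\<dots> \<le> C * (fact (N + n) * exp 2)"
      proof -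
        have "0 \<le> (\<bar>t\<bar> - 1 / 2)\<^sup>2" by simp
        then have "1 + \<bar>t\<bar> - t\<^sup>2 \<le> 2" by (simp add: power2_diff power_divide)
        then show ?thesis using C(1) by (intro mult_left_mono) auto
      qed
      finally show "(1 + \<bar>t\<bar>) ^ N * cmod (F k t) \<le> C * (fact (N + n) * exp 2)" .
    qed
    then show ?thesis by blast
  qed
  with deriv obtain g where "\<And>k. sder k g = F k" using schwartz_of_tower[of F] by blast
  then have "\<And>t. sder 0 g t = exp (- (of_real t)\<^sup>2)" by (simp add: F_def q0)
  with that show ?thesis .
qed

text \<open>The derivative of exp(-l t) \<psi> is exp(-l t) (\<psi>' - l \<psi>), so the k-th
  derivative of the product is exp(-l t) times \<open>G k\<close>, and for imaginary l the factor
  has modulus 1. Forming \<open>G k\<close> consumes k orders, so starting from order N + N leaves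
  at least N for every k \<le> N.\<close>

lemma modulation_ex:
  assumes l: "Re l = 0"
  obtains \<eta> where "sder 0 \<eta> = (\<lambda>t. exp (- l * of_real t) * sder 0 \<phi> t)"
    and "\<And>N r. wbound (N + N) r \<phi> \<Longrightarrow> wbound N ((1 + cmod l) ^ N * r) \<eta>"
proof -
  define G where "G k = ((\<lambda>\<psi>. schwartz_deriv \<psi> - schwartz_scale l \<psi>) ^^ k) \<phi>" for k
  have G0: "G 0 = \<phi>" and G_Suc: "G (Suc k) = schwartz_deriv (G k) - schwartz_scale l (G k)" for k
    by (simp_all add: G_def)
  define F where "F k t = exp (- l * of_real t) * sder 0 (G k) t" for k t
  have deriv: "(F k has_vector_derivative F (Suc k) t) (at t)" for k t
    unfolding F_def
    by (rule has_vector_derivative_eq_rhs[OF has_vector_derivative_mult[OF exp_has_vector_derivative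
          sder_has_vector_derivative]])
      (simp add: G_Suc sder_minus sder_scale sder_deriv algebra_simps)
  have norm_exp: "cmod (exp (- l * of_real t)) \<le> 1" for t using l by simp
  have decay_F: "decay N (1 * r) (F k)" if "decay N r (sder 0 (G k))" for N r k
    unfolding F_def by (rule decay_mult[OF that norm_exp])
  have "\<exists>C. decay N C (F k)" for N k
    using decay_F sder_decay_ex by blast
  with deriv obtain \<eta> where \<eta>: "\<And>k. sder k \<eta> = F k" using schwartz_of_tower[of F] by blast
  show ?thesis
  proof (rule that)
    show "sder 0 \<eta> = (\<lambda>t. exp (- l * of_real t) * sder 0 \<phi> t)"
      unfolding \<eta> by (simp add: F_def[abs_def] G0)
    fix N r assume \<phi>: "wbound (N + N) r \<phi>"
    have r: "0 \<le> r" by (rule wbound_nonneg[OF \<phi>])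
    have G: "wbound (N + N - k) ((1 + cmod l) ^ k * r) (G k)" if "k \<le> N" for k
      using that
    proof (induction k)
      case 0
      then show ?case using \<phi> by (simp add: G0)
    next
      case (Suc k)
      let ?r = "(1 + cmod l) ^ k * r"
      have IH: "wbound (Suc (N + N - Suc k)) ?r (G k)"
        using Suc by (simp add: Suc_diff_Suc)
      have "wbound (N + N - Suc k) (?r + cmod l * ?r) (G (Suc k))"
        unfolding G_Suc using wbound_antimono[OF IH]
        by (intro wbound_minus wbound_scale wbound_deriv[OF IH]) auto
      then show ?case by (simp add: algebra_simps)
    qed
    show "wbound N ((1 + cmod l) ^ N * r) \<eta>"
      unfolding wbound_def \<eta>
    proof (intro allI impI)
      fix k assume k: "k \<le> N"
      have "(1 + cmod l) ^ k * r \<le> (1 + cmod l) ^ N * r"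
        using k r by (intro mult_right_mono power_increasing) auto
      then have "wbound N ((1 + cmod l) ^ N * r) (G k)"
        using k by (intro wbound_antimono[OF G[OF k]]) auto
      then have "decay N ((1 + cmod l) ^ N * r) (sder 0 (G k))"
        unfolding wbound_def by (meson le0)
      from decay_F[OF this] show "decay N ((1 + cmod l) ^ N * r) (F k)" by simp
    qed
  qed
qed

lemma integrating_factor_schwartz:
  assumes "schwartz_deriv \<psi> + schwartz_scale l \<psi> = \<phi>"
  shows "((\<lambda>t. exp (l * of_real t) * sder 0 \<psi> t) has_vector_derivative
    exp (l * of_real t) * sder 0 \<phi> t) (at t)"
proof (rule has_vector_derivative_eq_rhs[OF has_vector_derivative_mult[OF exp_has_vector_derivative
        sder_has_vector_derivative]])
  show "exp (l * of_real t) * sder (Suc 0) \<psi> t + l * exp (l * of_real t) * sder 0 \<psi> t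
    = exp (l * of_real t) * sder 0 \<phi> t"
    unfolding sder_ode[OF assms, of 0] by (simp add: algebra_simps)
qed

lemma zero_vector_derivative_const:
  fixes w :: "real \<Rightarrow> complex"
  assumes "\<And>t. (w has_vector_derivative 0) (at t)"
  shows "\<exists>c. \<forall>t. w t = c"
  using has_vector_derivative_zero_constant[of UNIV w] assms by (metis UNIV_I convex_UNIV)

text \<open>A solution is c exp(-l t), which is unbounded on one side unless c = 0.\<close>

lemma ode_unique_Re_nonzero:
  assumes l: "Re l \<noteq> 0" and \<psi>: "schwartz_deriv \<psi> + schwartz_scale l \<psi> = 0"
  shows "\<psi> = 0"
proof -
  have "((\<lambda>t. exp (l * of_real t) * sder 0 \<psi> t) has_vector_derivative 0) (at t)" for t
    using integrating_factor_schwartz[OF \<psi>, of t] by (simp add: sder_zero)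
  from zero_vector_derivative_const[OF this]
  obtain c where c: "\<And>t. exp (l * of_real t) * sder 0 \<psi> t = c" by blast
  obtain R where R: "decay 0 R (sder 0 \<psi>)" using sder_decay_ex by blast
  have R0: "0 \<le> R" by (rule decay_nonneg[OF R])
  have "c = 0"
  proof (rule ccontr)
    assume "c \<noteq> 0"
    then have c0: "cmod c > 0" by simp
    \<comment> \<open>At t = -s / Re l boundedness gives exp(s) |c| \<le> R; this s makes already (1
      + s) |c| = |c| + R exceed R.\<close>
    define s where "s = R / cmod c"
    have "cmod c = exp (- s) * cmod (sder 0 \<psi> (- (s / Re l)))"
      using arg_cong[OF c[of "- (s / Re l)"], of cmod] l by (simp add: norm_mult)
    then have "cmod c \<le> exp (- s) * R" using decay_norm_le[OF R] by (simp add: mult_left_mono)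
    then have "exp s * cmod c \<le> R" by (simp add: exp_minus field_simps)
    moreover have "(1 + s) * cmod c \<le> exp s * cmod c" by (intro mult_right_mono exp_ge_add_one_self) auto
    moreover have "(1 + s) * cmod c = cmod c + R" using c0 by (simp add: s_def field_simps)
    ultimately show False using c0 by simp
  qed
  then show ?thesis using c by (intro schwartz_eqI) (simp add: sder_zero)
qed

text \<open>The one quantity through which the size of the left inverse depends on l. On the
  imaginary axis the last term is a constant, in accordance with \<open>root_distance\<close>, which
  ignores imaginary roots.\<close>

definition ode_const :: "complex \<Rightarrow> real" where
  "ode_const l = 1 + cmod l + (if Re l = 0 then 1 else 1 / \<bar>Re l\<bar>)"

lemma ode_const_ge: "1 \<le> ode_const l" "1 + cmod l \<le> ode_const l"
  by (simp_all add: ode_const_def)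

text \<open>The drop from 2 * N + 2 to N makes room for the two powers of the weight lost in
  integration, in one shape for all l. \<open>M\<close> may depend on N but not on the test
  function, so the last clause is continuity with explicit constants.\<close>

definition ode_left_inverse :: "complex \<Rightarrow> (nat \<Rightarrow> real) \<Rightarrow> (schwartz \<Rightarrow> schwartz) \<Rightarrow> bool" where
  "ode_left_inverse l M B \<longleftrightarrow>
    (\<forall>\<phi> \<psi>. B (\<phi> + \<psi>) = B \<phi> + B \<psi>) \<and>
    (\<forall>c \<phi>. B (schwartz_scale c \<phi>) = schwartz_scale c (B \<phi>)) \<and>
    (\<forall>\<phi>. B (schwartz_deriv \<phi> + schwartz_scale l \<phi>) = \<phi>) \<and>
    (\<forall>N r \<phi>. wbound (2 * N + 2) r \<phi> \<longrightarrow> wbound N (M N * r) (B \<phi>))"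

text \<open>\<open>schwartz_deriv + l\<close> is injective but for imaginary \<open>l\<close> not onto; a fixed \<open>\<gamma>\<close> outside its
  range makes up for the missing dimension, and uniqueness of the solution makes it linear.\<close>

lemma left_inverse_of_solvable:
  assumes solvable: "\<And>\<phi>. \<exists>\<psi> c. schwartz_deriv \<psi> + schwartz_scale l \<psi> = \<phi> + schwartz_scale c \<gamma> \<and>
      (\<forall>N r. wbound (2 * N + 2) r \<phi> \<longrightarrow> wbound N (M N * r) \<psi>)"
    and unique: "\<And>\<psi> c. schwartz_deriv \<psi> + schwartz_scale l \<psi> = schwartz_scale c \<gamma> \<Longrightarrow> \<psi> = 0"
  shows "\<exists>B. ode_left_inverse l M B"
proof -
  let ?D = "\<lambda>\<psi>. schwartz_deriv \<psi> + schwartz_scale l \<psi>"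
  have D_add: "?D (\<phi> + \<psi>) = ?D \<phi> + ?D \<psi>" for \<phi> \<psi>
    by (rule schwartz_eqI) (simp add: sder_add sder_scale sder_deriv algebra_simps)
  have D_scale: "?D (schwartz_scale c \<phi>) = schwartz_scale c (?D \<phi>)" for c \<phi>
    by (rule schwartz_eqI) (simp add: sder_add sder_scale sder_deriv algebra_simps)
  from solvable obtain B c where B: "\<And>\<phi>. ?D (B \<phi>) = \<phi> + schwartz_scale (c \<phi>) \<gamma>"
    "\<And>N r \<phi>. wbound (2 * N + 2) r \<phi> \<Longrightarrow> wbound N (M N * r) (B \<phi>)" by metis
  have B_eq: "B \<phi> = \<psi>" if "?D \<psi> = \<phi> + schwartz_scale d \<gamma>" for \<phi> \<psi> d
  proof -
    have "?D (B \<phi> + schwartz_scale (-1) \<psi>) = schwartz_scale (c \<phi> - d) \<gamma>"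
      unfolding D_add D_scale B that
      by (rule schwartz_eqI) (simp add: sder_add sder_scale sder_deriv algebra_simps)
    from unique[OF this] have "B \<phi> - \<psi> = 0" by (simp add: minus_schwartz_def uminus_schwartz_def)
    then show ?thesis by simp
  qed
  show ?thesis
    unfolding ode_left_inverse_def
  proof (intro exI[of _ B] conjI allI impI)
    show "B (\<phi> + \<psi>) = B \<phi> + B \<psi>" for \<phi> \<psi>
    proof (rule B_eq)
      show "?D (B \<phi> + B \<psi>) = \<phi> + \<psi> + schwartz_scale (c \<phi> + c \<psi>) \<gamma>"
        unfolding D_add B by (rule schwartz_eqI) (simp add: sder_add sder_scale algebra_simps)
    qed
    show "B (schwartz_scale a \<phi>) = schwartz_scale a (B \<phi>)" for a \<phi>
    proof (rule B_eq)
      show "?D (schwartz_scale a (B \<phi>)) = schwartz_scale a \<phi> + schwartz_scale (a * c \<phi>) \<gamma>"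
        unfolding D_scale B by (rule schwartz_eqI) (simp add: sder_add sder_scale algebra_simps)
    qed
    show "B (?D \<phi>) = \<phi>" for \<phi>
    proof (rule B_eq)
      show "?D \<phi> = ?D \<phi> + schwartz_scale 0 \<gamma>"
        by (rule schwartz_eqI) (simp add: sder_add sder_scale)
    qed
  qed (rule B(2))
qed

lemma ode_const_nonneg [simp]: "0 \<le> ode_const l"
  using ode_const_ge(1)[of l] by linarith

text \<open>Here the operator is onto, so the correcting direction \<gamma> is taken to be 0.
  \<open>Q\<close> is chosen before l: as l runs through the roots for all \<xi>, only the power of
  \<open>ode_const\<close> may vary.\<close>

lemma left_inverse_Re_nonzero:
  obtains Q where "\<And>l. Re l \<noteq> 0 \<Longrightarrow>
      \<exists>B. ode_left_inverse l (\<lambda>N. Q N * ode_const l ^ (2 * N + 2)) B"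
proof -
  define C :: "nat \<Rightarrow> real" where "C N = 2 * 4 ^ Suc N * fact N" for N
  have C: "0 \<le> C N" for N by (simp add: C_def)
  have "\<exists>B. ode_left_inverse l (\<lambda>N. (C N + 1) * ode_const l ^ (2 * N + 2)) B"
    if l: "Re l \<noteq> 0" for l
  proof -
    let ?b = "ode_const l"
    have "\<exists>\<psi> c. schwartz_deriv \<psi> + schwartz_scale l \<psi> = \<phi> + schwartz_scale c 0 \<and>
      (\<forall>N r. wbound (2 * N + 2) r \<phi> \<longrightarrow> wbound N ((C N + 1) * ?b ^ (2 * N + 2) * r) \<psi>)" for \<phi>
    proof -
      obtain r0 where "decay 0 r0 (sder 0 \<phi>)" using sder_decay_ex by blast
      from solve_ode_Re_nonzero[OF isCont_sder this l]
      obtain f where f: "\<And>t. (f has_vector_derivative sder 0 \<phi> t - l * f t) (at t)"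
        "\<And>N r. decay N r (sder 0 \<phi>) \<Longrightarrow> decay N (C N * (1 + 1 / \<bar>Re l\<bar>) ^ Suc N * r) f"
        unfolding C_def by blast
      have "\<exists>c. decay N c f" for N using f(2) sder_decay_ex by blast
      from schwartz_solution_of_ode[OF f(1) this]
      obtain \<psi> where \<psi>: "sder 0 \<psi> = f" "schwartz_deriv \<psi> + schwartz_scale l \<psi> = \<phi>" by blast
      have "wbound N ((C N + 1) * ?b ^ (2 * N + 2) * r) \<psi>" if \<phi>: "wbound (2 * N + 2) r \<phi>" for N r
      proof -
        have r: "0 \<le> r" by (rule wbound_nonneg[OF \<phi>])
        have \<phi>N: "wbound N r \<phi>" using \<phi> by (rule wbound_antimono) auto
        then have "decay N r (sder 0 \<phi>)" by (rule wbound_imp_decay) simp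
        from f(2)[OF this] have "decay N (C N * ?b ^ Suc N * r) (sder 0 \<psi>)"
          unfolding \<psi>(1)
        proof (rule decay_antimono)
          show "C N * (1 + 1 / \<bar>Re l\<bar>) ^ Suc N * r \<le> C N * ?b ^ Suc N * r"
            using l r C by (intro mult_right_mono mult_left_mono power_mono) (auto simp: ode_const_def)
        qed simp
        from wbound_of_ode[OF \<psi>(2) this \<phi>N] show ?thesis
        proof (rule wbound_antimono)
          \<comment> \<open>N factors stem from eliminating derivatives and N + 1 from the integral;
            the exponent is then raised to the common value 2 * N + 2.\<close>
          have "(1 + cmod l) ^ N * (C N * ?b ^ Suc N * r + r) \<le> ?b ^ N * (C N * ?b ^ Suc N * r + ?b ^ Suc N * r)"
          proof (intro mult_mono power_mono ode_const_ge(2) add_mono order_refl)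
            have "1 * r \<le> ?b ^ Suc N * r" using r ode_const_ge(1) by (intro mult_right_mono one_le_power) auto
            then show "r \<le> ?b ^ Suc N * r" by simp
          qed (use r C in auto)
          also have "\<dots> = (C N + 1) * ?b ^ (N + Suc N) * r"
            unfolding power_add by (simp add: algebra_simps)
          also have "\<dots> \<le> (C N + 1) * ?b ^ (2 * N + 2) * r"
            using r C[of N] ode_const_ge(1) by (intro mult_right_mono mult_left_mono power_increasing) auto
          finally show "(1 + cmod l) ^ N * (C N * ?b ^ Suc N * r + r) \<le> (C N + 1) * ?b ^ (2 * N + 2) * r" .
        qed simp
      qed
      moreover have "schwartz_scale 0 0 = 0" by (rule schwartz_eqI) (simp add: sder_scale sder_zero)
      ultimately show ?thesis using \<psi>(2) by (intro exI[of _ \<psi>] exI[of _ 0]) simp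
    qed
    moreover have "\<psi> = 0" if "schwartz_deriv \<psi> + schwartz_scale l \<psi> = schwartz_scale c 0" for \<psi> c
    proof (rule ode_unique_Re_nonzero[OF l])
      have "schwartz_scale c 0 = 0" by (rule schwartz_eqI) (simp add: sder_scale sder_zero)
      with that show "schwartz_deriv \<psi> + schwartz_scale l \<psi> = 0" by simp
    qed
    ultimately show ?thesis by (rule left_inverse_of_solvable)
  qed
  then show ?thesis by (rule that)
qed

text \<open>\<Gamma> is the Gaussian integral. It is nonzero because the real part of
  \<open>G\<close> increases strictly from its limit 0; the integral is not evaluated.\<close>

lemma gaussian_primitive_ex:
  obtains G \<Gamma> where "\<And>t. (G has_vector_derivative exp (- (complex_of_real t)\<^sup>2)) (at t)"
    and "(G \<longlongrightarrow> 0) at_bot" "(G \<longlongrightarrow> \<Gamma>) at_top" "\<Gamma> \<noteq> 0"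
proof -
  obtain g where g: "\<And>t. sder 0 g t = exp (- (of_real t)\<^sup>2)" using gaussian_ex by blast
  obtain r where r: "decay 2 r (sder 0 g)" using sder_decay_ex by blast
  obtain G0 where G0: "\<And>t. (G0 has_vector_derivative sder 0 g t) (at t)"
    using antiderivative_ex[OF isCont_sder] by blast
  obtain W where W: "(G0 \<longlongrightarrow> W) at_bot" using primitive_tendsto_at_bot[OF G0 r] .
  define G where "G t = G0 t - W" for t
  have G: "(G has_vector_derivative sder 0 g t) (at t)" for t
    unfolding G_def using has_vector_derivative_diff[OF G0 has_vector_derivative_const] by simp
  have bot: "(G \<longlongrightarrow> 0) at_bot" unfolding G_def using W by (simp add: LIM_zero_iff)
  obtain \<Gamma> where top: "(G \<longlongrightarrow> \<Gamma>) at_top" using primitive_tendsto_at_top[OF G r] .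
  have "((\<lambda>t. Re (G t)) has_real_derivative Re (sder 0 g t)) (at t)" for t
    using bounded_linear.has_vector_derivative[OF bounded_linear_Re G]
    by (simp add: has_real_derivative_iff_has_vector_derivative)
  moreover have "sder 0 g t = of_real (exp (- t\<^sup>2))" for t
    unfolding g by (simp add: exp_of_real[symmetric])
  ultimately have deriv: "((\<lambda>t. Re (G t)) has_real_derivative exp (- t\<^sup>2)) (at t)" for t
    by simp
  have mono: "Re (G s) < Re (G t)" if "s < t" for s t
    using deriv by (intro DERIV_pos_imp_increasing[OF that]) (blast intro: exp_gt_zero)
  have "0 \<le> Re (G 0)"
  proof (rule tendsto_upperbound)
    show "((\<lambda>t. Re (G t)) \<longlongrightarrow> 0) at_bot" using tendsto_Re[OF bot] by simp
    show "\<forall>\<^sub>F t in at_bot. Re (G t) \<le> Re (G 0)"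
      using eventually_gt_at_bot[of 0] by eventually_elim (simp add: mono less_imp_le)
  qed simp
  also have "Re (G 0) < Re (G 1)" by (rule mono) simp
  also have "Re (G 1) \<le> Re \<Gamma>"
  proof (rule tendsto_lowerbound)
    show "((\<lambda>t. Re (G t)) \<longlongrightarrow> Re \<Gamma>) at_top" by (rule tendsto_Re[OF top])
    show "\<forall>\<^sub>F t in at_top. Re (G 1) \<le> Re (G t)"
      using eventually_gt_at_top[of 1] by eventually_elim (simp add: mono less_imp_le)
  qed simp
  finally have "\<Gamma> \<noteq> 0" by auto
  with G bot top show ?thesis by (intro that) (simp_all only: g)
qed

lemma decay_tendsto_zero:
  assumes "decay 1 r f"
  shows "(f \<longlongrightarrow> 0) at_bot" "(f \<longlongrightarrow> 0) at_top"
proof -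
  have le: "cmod (f t) \<le> r / (1 + \<bar>t\<bar>)" for t
    using decayD[OF assms, of t] by (simp add: pos_le_divide_eq mult.commute)
  have top: "((\<lambda>t::real. r / (1 + \<bar>t\<bar>)) \<longlongrightarrow> 0) at_top"
    by (intro real_tendsto_divide_at_top[OF tendsto_const]
        filterlim_tendsto_add_at_top[OF tendsto_const] filterlim_abs_real)
  have bot: "((\<lambda>t::real. r / (1 + \<bar>t\<bar>)) \<longlongrightarrow> 0) at_bot"
    using top by (simp add: filterlim_at_bot_mirror)
  show "(f \<longlongrightarrow> 0) at_bot" "(f \<longlongrightarrow> 0) at_top"
    by (rule Lim_null_comparison[OF always_eventually bot], use le in blast)
      (rule Lim_null_comparison[OF always_eventually top], use le in blast)
qed

text \<open>The function exp(l t) \<psi> is a primitive of exp(l t) \<phi>, and it can vanish at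
  both ends only if the integral of the latter is 0. The direction \<gamma> = exp(-l t) g is
  modulated so that exp(l t) \<gamma> is the same Gaussian g for every l; thus \<Gamma>,
  \<open>R\<close> and \<open>K\<close> do not depend on l.\<close>

lemma left_inverse_Re_zero:
  obtains Q where "\<And>l. Re l = 0 \<Longrightarrow>
      \<exists>B. ode_left_inverse l (\<lambda>N. Q N * ode_const l ^ (2 * N + 2)) B"
proof -
  obtain g where g: "\<And>t. sder 0 g t = exp (- (of_real t)\<^sup>2)" using gaussian_ex by blast
  obtain G \<Gamma> where G: "\<And>t. (G has_vector_derivative sder 0 g t) (at t)"
    and G_lim: "(G \<longlongrightarrow> 0) at_bot" "(G \<longlongrightarrow> \<Gamma>) at_top" and \<Gamma>: "\<Gamma> \<noteq> 0"
    using gaussian_primitive_ex unfolding g by blast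
  \<comment> \<open>Order 2 * N + 2 for g covers both of its uses: N + 2 for the decay of the
    corrected integrand and N + N for the modulation.\<close>
  have "\<exists>R. \<forall>N. 0 < R N \<and> wbound (2 * N + 2) (R N) g"
    by (rule choice) (use ex_wbound in blast)
  then obtain R where R: "\<And>N. 0 < R N" "\<And>N. wbound (2 * N + 2) (R N) g" by blast
  \<comment> \<open>The coefficient of the correction is at most (pi / |\<Gamma>|) r and g
    contributes \<open>R N\<close>, so \<open>K N * r\<close> bounds the corrected
    integrand.\<close>
  define K where "K N = 1 + pi / cmod \<Gamma> * R N" for N
  have K: "1 \<le> K N" for N using R(1)[of N] by (simp add: K_def)
  have "\<exists>B. ode_left_inverse l (\<lambda>N. (pi + 1) * K N * ode_const l ^ (2 * N + 2)) B"
    if l: "Re l = 0" for l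
  proof -
    let ?b = "ode_const l"
    obtain \<gamma> where \<gamma>: "sder 0 \<gamma> = (\<lambda>t. exp (- l * of_real t) * sder 0 g t)"
      "\<And>N r. wbound (N + N) r g \<Longrightarrow> wbound N ((1 + cmod l) ^ N * r) \<gamma>"
      using modulation_ex[OF l] by blast
    have exp_cancel: "exp (l * of_real t) * exp (- l * of_real t) = 1" for t :: real
      by (simp add: exp_minus)
    have exp_\<gamma>: "exp (l * of_real t) * sder 0 \<gamma> t = sder 0 g t" for t
      unfolding \<gamma>(1) by (simp only: mult.assoc[symmetric] exp_cancel mult_1)
    have norm_exp: "cmod (exp (l * of_real t)) \<le> 1" "cmod (exp (- l * of_real t)) \<le> 1" for t
      using l by simp_all
    have "\<exists>\<psi> c. schwartz_deriv \<psi> + schwartz_scale l \<psi> = \<phi> + schwartz_scale c \<gamma> \<and>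
      (\<forall>N r. wbound (2 * N + 2) r \<phi> \<longrightarrow> wbound N ((pi + 1) * K N * ?b ^ (2 * N + 2) * r) \<psi>)" for \<phi>
    proof -
      define f where "f t = exp (l * of_real t) * sder 0 \<phi> t" for t
      have f_decay: "decay N r f" if "decay N r (sder 0 \<phi>)" for N r
        unfolding f_def using decay_mult[OF that norm_exp(1)] by simp
      have "isCont f t" for t unfolding f_def by (intro continuous_intros isCont_sder)
      then obtain u0 where u0: "\<And>t. (u0 has_vector_derivative f t) (at t)"
        using antiderivative_ex by blast
      obtain r0 where r0: "decay 2 r0 f" using f_decay sder_decay_ex by blast
      obtain W where W: "(u0 \<longlongrightarrow> W) at_bot" using primitive_tendsto_at_bot[OF u0 r0] .
      define u where "u t = u0 t - W" for t
      have u: "(u has_vector_derivative f t) (at t)" for t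
        unfolding u_def using has_vector_derivative_diff[OF u0 has_vector_derivative_const] by simp
      have u_bot: "(u \<longlongrightarrow> 0) at_bot" unfolding u_def using W by (simp add: LIM_zero_iff)
      obtain U where u_top: "(u \<longlongrightarrow> U) at_top" using primitive_tendsto_at_top[OF u r0] .
      \<comment> \<open>\<open>U\<close> is the integral of f and \<Gamma> that of g, so f + c g has
        integral 0 and its primitive \<open>w\<close> vanishes at both ends.\<close>
      define c where "c = - U / \<Gamma>"
      define w where "w t = u t + c * G t" for t
      have w: "(w has_vector_derivative f t + c * sder 0 g t) (at t)" for t
        unfolding w_def by (intro has_vector_derivative_add u has_vector_derivative_mult_right G)
      have w_lim: "(w \<longlongrightarrow> 0) at_bot" "(w \<longlongrightarrow> 0) at_top"
        unfolding w_def using tendsto_add[OF u_bot tendsto_mult_left[OF G_lim(1), of c]]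
          tendsto_add[OF u_top tendsto_mult_left[OF G_lim(2), of c]] \<Gamma> by (simp_all add: c_def)
      have w_eq: "f t + c * sder 0 g t = exp (l * of_real t) * sder 0 (\<phi> + schwartz_scale c \<gamma>) t" for t
        unfolding exp_\<gamma>[symmetric] by (simp add: f_def sder_add sder_scale algebra_simps)
      have c_le: "cmod c \<le> pi / cmod \<Gamma> * r" if "decay 2 r f" for r
        using primitive_limit_le[OF u that u_bot u_top] \<Gamma>
        by (simp add: c_def norm_divide divide_right_mono)
      have w_decay: "decay N (pi * (K N * r)) w" if \<phi>: "wbound (2 * N + 2) r \<phi>" for N r
      proof (rule primitive_decay[OF w _ w_lim])
        have r: "0 \<le> r" by (rule wbound_nonneg[OF \<phi>])
        have f: "decay (N + 2) r f" "decay 2 r f"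
          by (intro f_decay wbound_imp_decay[OF \<phi>]; simp)+
        have "decay (N + 2) (R N) (sder 0 g)"
          by (rule wbound_imp_decay[OF R(2)]) simp
        from decay_add[OF f(1) decay_mult[OF this, of "\<lambda>_. c" "cmod c"]]
        have "decay (N + 2) (r + cmod c * R N) (\<lambda>t. f t + c * sder 0 g t)" by simp
        then show "decay (N + 2) (K N * r) (\<lambda>t. f t + c * sder 0 g t)"
        proof (rule decay_antimono)
          show "r + cmod c * R N \<le> K N * r"
            using mult_right_mono[OF c_le[OF f(2)] less_imp_le[OF R(1)[of N]]] by (simp add: K_def algebra_simps)
        qed simp
      qed
      have norm_eq: "decay N r (\<lambda>t. exp (- l * of_real t) * w t)" if "decay N r w" for N r
        using decay_mult[OF that norm_exp(2)] by simp
      have ode: "((\<lambda>t. exp (- l * of_real t) * w t) has_vector_derivative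
          sder 0 (\<phi> + schwartz_scale c \<gamma>) t - l * (exp (- l * of_real t) * w t)) (at t)" for t
        by (rule integrating_factor) (use w[of t] in \<open>simp only: w_eq\<close>)
      have "\<exists>C. decay N C (\<lambda>t. exp (- l * of_real t) * w t)" for N
        using norm_eq w_decay ex_wbound by blast
      from schwartz_solution_of_ode[OF ode this] obtain \<psi>
        where \<psi>: "sder 0 \<psi> = (\<lambda>t. exp (- l * of_real t) * w t)"
          "schwartz_deriv \<psi> + schwartz_scale l \<psi> = \<phi> + schwartz_scale c \<gamma>" by blast
      have "wbound N ((pi + 1) * K N * ?b ^ (2 * N + 2) * r) \<psi>" if \<phi>: "wbound (2 * N + 2) r \<phi>" for N r
      proof -
        have r: "0 \<le> r" by (rule wbound_nonneg[OF \<phi>])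
        have "decay 2 r f"
          by (intro f_decay wbound_imp_decay[OF \<phi>]) simp
        note c = c_le[OF this]
        have "wbound (N + N) (R N) g" using R(2) by (rule wbound_antimono) auto
        from wbound_scale[OF \<gamma>(2)[OF this], of c]
        have rhs: "wbound N (r + cmod c * ((1 + cmod l) ^ N * R N)) (\<phi> + schwartz_scale c \<gamma>)"
          using wbound_antimono[OF \<phi>] by (intro wbound_add) auto
        have "wbound N (?b ^ N * (K N * r)) (\<phi> + schwartz_scale c \<gamma>)"
        proof (rule wbound_antimono[OF rhs order_refl])
          have "r + cmod c * ((1 + cmod l) ^ N * R N) \<le> ?b ^ N * r + (pi / cmod \<Gamma> * r) * (?b ^ N * R N)"
          proof (intro add_mono mult_mono power_mono ode_const_ge(2) c order_refl)
            have "1 * r \<le> ?b ^ N * r" using r ode_const_ge(1) by (intro mult_right_mono one_le_power) auto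
            then show "r \<le> ?b ^ N * r" by simp
          qed (use r R(1)[of N] in \<open>auto intro!: mult_nonneg_nonneg\<close>)
          also have "\<dots> = ?b ^ N * (K N * r)" by (simp add: K_def algebra_simps)
          finally show "r + cmod c * ((1 + cmod l) ^ N * R N) \<le> ?b ^ N * (K N * r)" .
        qed
        from wbound_of_ode[OF \<psi>(2) norm_eq[OF w_decay[OF \<phi>], folded \<psi>(1)] this]
        show ?thesis
        proof (rule wbound_antimono)
          have Kr: "0 \<le> K N * r" using K[of N] r by simp
          have "(1 + cmod l) ^ N * (pi * (K N * r) + ?b ^ N * (K N * r))
            \<le> ?b ^ N * (?b ^ N * (pi * (K N * r)) + ?b ^ N * (K N * r))"
          proof (rule mult_mono)
            show "(1 + cmod l) ^ N \<le> ?b ^ N" by (intro power_mono ode_const_ge(2)) simp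
            have "1 * (pi * (K N * r)) \<le> ?b ^ N * (pi * (K N * r))"
              using Kr ode_const_ge(1) by (intro mult_right_mono one_le_power) auto
            then show "pi * (K N * r) + ?b ^ N * (K N * r) \<le> ?b ^ N * (pi * (K N * r)) + ?b ^ N * (K N * r)"
              by simp
          qed (use Kr in auto)
          also have "\<dots> = (pi + 1) * K N * ?b ^ (N + N) * r"
            unfolding power_add by (simp add: algebra_simps)
          also have "\<dots> \<le> (pi + 1) * K N * ?b ^ (2 * N + 2) * r"
            using r K[of N] ode_const_ge(1) pi_gt_zero
            by (intro mult_right_mono mult_left_mono power_increasing) auto
          finally show "(1 + cmod l) ^ N * (pi * (K N * r) + ?b ^ N * (K N * r))
            \<le> (pi + 1) * K N * ?b ^ (2 * N + 2) * r" .
        qed simp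
      qed
      with \<psi>(2) show ?thesis by blast
    qed
    moreover have "\<psi> = 0" if \<psi>: "schwartz_deriv \<psi> + schwartz_scale l \<psi> = schwartz_scale c \<gamma>" for \<psi> c
    proof -
      \<comment> \<open>This \<open>w\<close> differs from c \<open>G\<close> by a constant and
        vanishes at both ends: the left end makes the constant 0, the right end then forces c
        \<Gamma> = 0.\<close>
      define w where "w t = exp (l * of_real t) * sder 0 \<psi> t" for t
      have rhs: "exp (l * of_real t) * sder 0 (schwartz_scale c \<gamma>) t = c * sder 0 g t" for t
        unfolding exp_\<gamma>[symmetric] by (simp add: sder_scale)
      have w: "(w has_vector_derivative c * sder 0 g t) (at t)" for t
        using integrating_factor_schwartz[OF \<psi>, of t] unfolding rhs w_def[abs_def] .
      obtain r where "decay 1 r (sder 0 \<psi>)" using sder_decay_ex by blast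
      from decay_mult[OF this norm_exp(1)] have "decay 1 (1 * r) w" unfolding w_def[abs_def] .
      note w_lim = decay_tendsto_zero[OF this]
      have "((\<lambda>t. w t - c * G t) has_vector_derivative 0) (at t)" for t
        using has_vector_derivative_diff[OF w has_vector_derivative_mult_right[OF G, of c]] by simp
      from zero_vector_derivative_const[OF this] obtain k where k: "\<And>t. w t - c * G t = k" by blast
      have "((\<lambda>t. w t - c * G t) \<longlongrightarrow> 0 - c * 0) at_bot"
        by (intro tendsto_intros w_lim G_lim)
      then have "k = 0" unfolding k by (simp add: tendsto_const_iff)
      moreover have "((\<lambda>t. w t - c * G t) \<longlongrightarrow> 0 - c * \<Gamma>) at_top"
        by (intro tendsto_intros w_lim G_lim)
      then have "k = - (c * \<Gamma>)" unfolding k by (simp add: tendsto_const_iff)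
      ultimately have "c = 0" using \<Gamma> by simp
      then have "w t = 0" for t using k[of t] \<open>k = 0\<close> by simp
      then show ?thesis by (intro schwartz_eqI) (simp add: w_def sder_zero)
    qed
    ultimately show ?thesis by (rule left_inverse_of_solvable)
  qed
  then show ?thesis by (rule that)
qed

lemma ode_left_inverse_mono:
  assumes B: "ode_left_inverse l M B" and le: "\<And>N. M N \<le> M' N"
  shows "ode_left_inverse l M' B"
  unfolding ode_left_inverse_def
proof (intro conjI allI impI)
  fix N r \<phi> assume \<phi>: "wbound (2 * N + 2) r \<phi>"
  have "M N * r \<le> M' N * r" by (intro mult_right_mono le wbound_nonneg[OF \<phi>])
  moreover have "wbound N (M N * r) (B \<phi>)" using B \<phi> unfolding ode_left_inverse_def by blast
  ultimately show "wbound N (M' N * r) (B \<phi>)" by (meson wbound_antimono order_refl)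
qed (use B[unfolded ode_left_inverse_def] in blast)+

lemma left_inverse_ex:
  obtains Q where "\<And>l. \<exists>B. ode_left_inverse l (\<lambda>N. Q N * ode_const l ^ (2 * N + 2)) B"
proof -
  obtain Q1 where Q1: "\<And>l. Re l \<noteq> 0 \<Longrightarrow> \<exists>B. ode_left_inverse l (\<lambda>N. Q1 N * ode_const l ^ (2 * N + 2)) B"
    using left_inverse_Re_nonzero by blast
  obtain Q2 where Q2: "\<And>l. Re l = 0 \<Longrightarrow> \<exists>B. ode_left_inverse l (\<lambda>N. Q2 N * ode_const l ^ (2 * N + 2)) B"
    using left_inverse_Re_zero by blast
  define Q where "Q N = max (Q1 N) (Q2 N)" for N
  have le: "Q1 N * ode_const l ^ (2 * N + 2) \<le> Q N * ode_const l ^ (2 * N + 2)"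
    "Q2 N * ode_const l ^ (2 * N + 2) \<le> Q N * ode_const l ^ (2 * N + 2)" for l N
    unfolding Q_def by (intro mult_right_mono zero_le_power; simp)+
  have "\<exists>B. ode_left_inverse l (\<lambda>N. Q N * ode_const l ^ (2 * N + 2)) B" for l
  proof (cases "Re l = 0")
    case True
    then obtain B where "ode_left_inverse l (\<lambda>N. Q2 N * ode_const l ^ (2 * N + 2)) B" using Q2 by blast
    from ode_left_inverse_mono[OF this le(2)] show ?thesis by blast
  next
    case False
    then obtain B where "ode_left_inverse l (\<lambda>N. Q1 N * ode_const l ^ (2 * N + 2)) B" using Q1 by blast
    from ode_left_inverse_mono[OF this le(1)] show ?thesis by blast
  qed
  then show ?thesis by (rule that)
qed

section \<open>Polynomial growth on the lattice\<close>

text \<open>A one-sided bound, so that real majorants can be inserted directly; products therefore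
  ask for nonnegative factors.\<close>

definition poly_bounded :: "(int ^ 'n \<Rightarrow> real) \<Rightarrow> bool" where
  "poly_bounded f \<longleftrightarrow> (\<exists>k::nat. \<forall>\<xi>. f \<xi> \<le> real k * (1 + norm1 \<xi>) ^ k)"

lemma poly_growth_iff: "a \<in> poly_growth \<longleftrightarrow> poly_bounded (\<lambda>\<xi>. cmod (a \<xi>))"
  by (simp add: poly_growth_def poly_bounded_def)

lemma Y_iff: "T \<in> Y \<longleftrightarrow>
    (\<forall>\<xi>. T \<xi> \<in> tempered_distributions) \<and> (\<forall>\<phi>. poly_bounded (\<lambda>\<xi>. cmod (T \<xi> \<phi>)))"
  by (simp add: Y_def poly_bounded_def)

lemma norm1_nonneg: "0 \<le> norm1 \<xi>"
  by (simp add: norm1_def sum_nonneg)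

lemma component_le_norm1: "\<bar>of_int (\<xi> $ i)\<bar> \<le> norm1 \<xi>"
  unfolding norm1_def by (rule member_le_sum) auto

text \<open>Constant and exponent may be chosen separately: both can be raised to a common natural
  number because 1 + \<open>norm1 \<xi>\<close> is at least 1.\<close>

lemma poly_boundedI:
  fixes f :: "int ^ 'n \<Rightarrow> real"
  assumes "\<And>\<xi>. f \<xi> \<le> C * (1 + norm1 \<xi>) ^ k"
  shows "poly_bounded f"
  unfolding poly_bounded_def
proof (intro exI allI)
  fix \<xi> :: "int ^ 'n"
  let ?K = "max (nat \<lceil>C\<rceil>) k"
  have "C \<le> real ?K" by linarith
  then have "C * (1 + norm1 \<xi>) ^ k \<le> real ?K * (1 + norm1 \<xi>) ^ ?K"
    by (intro mult_mono power_increasing) (auto simp: norm1_nonneg)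
  with assms show "f \<xi> \<le> real ?K * (1 + norm1 \<xi>) ^ ?K" by (rule order_trans)
qed

lemma poly_bounded_mono: "poly_bounded g \<Longrightarrow> (\<And>\<xi>. f \<xi> \<le> g \<xi>) \<Longrightarrow> poly_bounded f"
  unfolding poly_bounded_def by (meson order_trans)

lemma poly_bounded_const: "poly_bounded (\<lambda>\<xi>. c)"
  by (rule poly_boundedI[of _ c 0]) simp

lemma poly_bounded_one_plus_norm1: "poly_bounded (\<lambda>\<xi>. 1 + norm1 \<xi>)"
  by (rule poly_boundedI[of _ 1 1]) simp

lemma poly_bounded_add:
  fixes f g :: "int ^ 'n \<Rightarrow> real"
  assumes "poly_bounded f" "poly_bounded g"
  shows "poly_bounded (\<lambda>\<xi>. f \<xi> + g \<xi>)"
proof -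
  obtain j k :: nat where j: "\<And>\<xi>. f \<xi> \<le> real j * (1 + norm1 \<xi>) ^ j"
    and k: "\<And>\<xi>. g \<xi> \<le> real k * (1 + norm1 \<xi>) ^ k"
    using assms unfolding poly_bounded_def by blast
  show ?thesis
  proof (rule poly_boundedI)
    fix \<xi> :: "int ^ 'n"
    have "real j * (1 + norm1 \<xi>) ^ j + real k * (1 + norm1 \<xi>) ^ k
      \<le> real j * (1 + norm1 \<xi>) ^ (j + k) + real k * (1 + norm1 \<xi>) ^ (j + k)"
      by (intro add_mono mult_left_mono power_increasing) (auto simp: norm1_nonneg)
    with j[of \<xi>] k[of \<xi>] show "f \<xi> + g \<xi> \<le> real (j + k) * (1 + norm1 \<xi>) ^ (j + k)"
      by (simp add: distrib_right)
  qed
qed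

lemma poly_bounded_mult:
  fixes f g :: "int ^ 'n \<Rightarrow> real"
  assumes "poly_bounded f" "poly_bounded g" "\<And>\<xi>. 0 \<le> f \<xi>" "\<And>\<xi>. 0 \<le> g \<xi>"
  shows "poly_bounded (\<lambda>\<xi>. f \<xi> * g \<xi>)"
proof -
  obtain j k :: nat where j: "\<And>\<xi>. f \<xi> \<le> real j * (1 + norm1 \<xi>) ^ j"
    and k: "\<And>\<xi>. g \<xi> \<le> real k * (1 + norm1 \<xi>) ^ k"
    using assms unfolding poly_bounded_def by blast
  show ?thesis
  proof (rule poly_boundedI)
    fix \<xi> :: "int ^ 'n"
    have "f \<xi> * g \<xi> \<le> (real j * (1 + norm1 \<xi>) ^ j) * (real k * (1 + norm1 \<xi>) ^ k)"
      by (intro mult_mono j k assms) (auto simp: norm1_nonneg)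
    then show "f \<xi> * g \<xi> \<le> real (j * k) * (1 + norm1 \<xi>) ^ (j + k)"
      by (simp add: power_add mult_ac)
  qed
qed

lemma poly_bounded_power:
  assumes "poly_bounded f" "\<And>\<xi>. 0 \<le> f \<xi>"
  shows "poly_bounded (\<lambda>\<xi>. f \<xi> ^ n)"
  by (induction n) (auto intro!: poly_bounded_const poly_bounded_mult zero_le_power assms)

lemma poly_bounded_sum:
  assumes "\<And>i. i \<in> I \<Longrightarrow> poly_bounded (f i)"
  shows "poly_bounded (\<lambda>\<xi>. \<Sum>i\<in>I. f i \<xi>)"
  using assms
  by (induction I rule: infinite_finite_induct) (auto intro!: poly_bounded_const poly_bounded_add)

lemma poly_bounded_prod:
  assumes "\<And>i. i \<in> I \<Longrightarrow> poly_bounded (f i)" "\<And>i \<xi>. 0 \<le> f i \<xi>"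
  shows "poly_bounded (\<lambda>\<xi>. \<Prod>i\<in>I. f i \<xi>)"
  using assms(1)
  by (induction I rule: infinite_finite_induct)
    (auto intro!: poly_bounded_const poly_bounded_mult prod_nonneg assms(2))

lemma poly_bounded_mpoly_eval:
  fixes q :: "('n::finite \<Rightarrow>\<^sub>0 nat) \<Rightarrow>\<^sub>0 complex"
  shows "poly_bounded (\<lambda>\<xi>. cmod (mpoly_eval q (\<lambda>i. \<i> * of_int (\<xi> $ i))))"
proof (rule poly_bounded_mono)
  show "poly_bounded (\<lambda>\<xi>. \<Sum>m\<in>Poly_Mapping.keys q. cmod (Poly_Mapping.lookup q m) *
      (\<Prod>i\<in>UNIV. (1 + norm1 \<xi>) ^ Poly_Mapping.lookup m i))"
    by (intro poly_bounded_sum poly_bounded_mult poly_bounded_const poly_bounded_prod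
        poly_bounded_power poly_bounded_one_plus_norm1 prod_nonneg ballI zero_le_power)
      (auto simp: norm1_nonneg)
  show "cmod (mpoly_eval q (\<lambda>i. \<i> * of_int (\<xi> $ i))) \<le> (\<Sum>m\<in>Poly_Mapping.keys q.
      cmod (Poly_Mapping.lookup q m) * (\<Prod>i\<in>UNIV. (1 + norm1 \<xi>) ^ Poly_Mapping.lookup m i))"
    for \<xi> :: "int ^ 'n"
    unfolding mpoly_eval_def
  proof (rule sum_norm_le)
    fix m
    have "(\<Prod>i\<in>UNIV. cmod ((\<i> * of_int (\<xi> $ i)) ^ Poly_Mapping.lookup m i))
      \<le> (\<Prod>i\<in>UNIV. (1 + norm1 \<xi>) ^ Poly_Mapping.lookup m i)"
    proof (intro prod_mono conjI norm_ge_zero)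
      fix i
      have "cmod (of_int (\<xi> $ i)) \<le> 1 + norm1 \<xi>"
        using component_le_norm1[of \<xi> i] by simp
      then show "cmod ((\<i> * of_int (\<xi> $ i)) ^ Poly_Mapping.lookup m i)
          \<le> (1 + norm1 \<xi>) ^ Poly_Mapping.lookup m i"
        by (simp add: norm_power norm_mult power_mono)
    qed
    then show "cmod (Poly_Mapping.lookup q m * (\<Prod>i\<in>UNIV. (\<i> * of_int (\<xi> $ i)) ^ Poly_Mapping.lookup m i))
      \<le> cmod (Poly_Mapping.lookup q m) * (\<Prod>i\<in>UNIV. (1 + norm1 \<xi>) ^ Poly_Mapping.lookup m i)"
      unfolding norm_mult prod_norm[symmetric] by (intro mult_left_mono) auto
  qed
qed

lemma coeff_symbol: "coeff (symbol P \<xi>) k = mpoly_eval (coeff P k) (\<lambda>i. \<i> * of_int (\<xi> $ i))"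
  unfolding symbol_def by (rule coeff_map_poly) (simp add: mpoly_eval_def)

lemma poly_bounded_coeff_symbol: "poly_bounded (\<lambda>\<xi>. cmod (coeff (symbol P \<xi>) k))"
  unfolding coeff_symbol by (rule poly_bounded_mpoly_eval)

lemma degree_symbol_le: "degree (symbol P \<xi>) \<le> degree P"
  unfolding symbol_def by (rule map_poly_degree_leq)

section \<open>Solving the equation\<close>

lemma tempered_add:
  "T \<in> tempered_distributions \<Longrightarrow> S \<in> tempered_distributions \<Longrightarrow>
    (\<lambda>\<phi>. T \<phi> + S \<phi>) \<in> tempered_distributions"
  by (auto simp: tempered_distributions_def algebra_simps intro: continuous_on_add)

lemma tempered_scale:
  "T \<in> tempered_distributions \<Longrightarrow> (\<lambda>\<phi>. c * T \<phi>) \<in> tempered_distributions"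
  by (auto simp: tempered_distributions_def algebra_simps intro: continuous_on_mult_left)

lemma tempered_sum:
  assumes "\<And>i. i \<in> I \<Longrightarrow> T i \<in> tempered_distributions"
  shows "(\<lambda>\<phi>. \<Sum>i\<in>I. T i \<phi>) \<in> tempered_distributions"
proof -
  have "(\<lambda>\<phi>. 0) \<in> tempered_distributions" by (simp add: tempered_distributions_def)
  then show ?thesis using assms
    by (induction I rule: infinite_finite_induct) (simp_all add: tempered_add)
qed

lemma schwartz_deriv_add: "schwartz_deriv (\<phi> + \<psi>) = schwartz_deriv \<phi> + schwartz_deriv \<psi>"
  by (rule schwartz_eqI) (simp add: sder_add sder_deriv)

lemma schwartz_deriv_scale: "schwartz_deriv (schwartz_scale c \<phi>) = schwartz_scale c (schwartz_deriv \<phi>)"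
  by (rule schwartz_eqI) (simp add: sder_scale sder_deriv)

lemma tempered_dist_deriv:
  assumes "T \<in> tempered_distributions"
  shows "dist_deriv T \<in> tempered_distributions"
proof -
  from assms obtain N C where lin: "schwartz_linear T"
    and C: "\<And>r \<phi>. wbound N r \<phi> \<Longrightarrow> cmod (T \<phi>) \<le> C * r"
    unfolding tempered_iff by blast
  have "schwartz_linear (dist_deriv T)"
    using lin by (simp add: schwartz_linear_def dist_deriv_def schwartz_deriv_add schwartz_deriv_scale)
  moreover have "cmod (dist_deriv T \<phi>) \<le> C * r" if "wbound (Suc N) r \<phi>" for r \<phi>
    using C[OF wbound_deriv[OF that]] by (simp add: dist_deriv_def)
  ultimately show ?thesis unfolding tempered_iff by blast
qed

lemma tempered_dist_deriv_funpow:
  "T \<in> tempered_distributions \<Longrightarrow> (dist_deriv ^^ k) T \<in> tempered_distributions"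
  by (induction k) (simp_all add: tempered_dist_deriv)

lemma dist_deriv_funpow: "(dist_deriv ^^ k) T \<phi> = (- 1) ^ k * T ((schwartz_deriv ^^ k) \<phi>)"
  by (induction k arbitrary: \<phi>) (simp_all add: dist_deriv_def funpow_swap1[of schwartz_deriv])

lemma dist_deriv_funpow_linear:
  "(dist_deriv ^^ k) (\<lambda>\<phi>. a * S \<phi> + b * T \<phi>) \<phi> = a * (dist_deriv ^^ k) S \<phi> + b * (dist_deriv ^^ k) T \<phi>"
  unfolding dist_deriv_funpow by (simp add: algebra_simps)

text \<open>The degree of a symbol may drop at individual \<xi>; summing up to a fixed n, such as
  the degree of P, gives a range independent of \<xi>.\<close>

lemma poly_dist_deriv_eq_sum:
  assumes "degree p \<le> n"
  shows "poly_dist_deriv p T \<phi> = (\<Sum>k\<le>n. coeff p k * (dist_deriv ^^ k) T \<phi>)"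
  unfolding poly_dist_deriv_def
  by (rule sum.mono_neutral_left) (use assms in \<open>auto simp: coeff_eq_0\<close>)

lemma poly_dist_deriv_smult: "poly_dist_deriv (smult c p) T \<phi> = c * poly_dist_deriv p T \<phi>"
  by (simp add: poly_dist_deriv_eq_sum[of _ "degree p"] degree_smult_le sum_distrib_left mult.assoc)

lemma poly_dist_deriv_1: "poly_dist_deriv 1 T = T"
  by (rule ext) (simp add: poly_dist_deriv_def)

text \<open>The linear factor acts on T first. The larger product is thus inverted by solving for p
  and then solving a first-order equation with that solution on the right-hand side.\<close>

lemma poly_dist_deriv_linear_factor:
  "poly_dist_deriv ([:- l, 1:] * p) T = poly_dist_deriv p (\<lambda>\<phi>. dist_deriv T \<phi> - l * T \<phi>)"
proof
  fix \<phi>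
  let ?n = "degree p"
  have eq: "[:- l, 1:] * p = smult (- l) p + pCons 0 p" by simp
  have deg: "degree ([:- l, 1:] * p) \<le> Suc ?n"
    using degree_mult_le[of "[:- l, 1:]" p] by simp
  have "poly_dist_deriv ([:- l, 1:] * p) T \<phi>
      = (\<Sum>k\<le>Suc ?n. - l * (coeff p k * (dist_deriv ^^ k) T \<phi>) + coeff (pCons 0 p) k * (dist_deriv ^^ k) T \<phi>)"
    unfolding poly_dist_deriv_eq_sum[OF deg] unfolding eq
    by (simp only: coeff_add coeff_smult distrib_right mult.assoc)
  also have "\<dots> = - l * (\<Sum>k\<le>Suc ?n. coeff p k * (dist_deriv ^^ k) T \<phi>)
      + (\<Sum>k\<le>Suc ?n. coeff (pCons 0 p) k * (dist_deriv ^^ k) T \<phi>)"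
    by (simp only: sum.distrib sum_distrib_left)
  also have "(\<Sum>k\<le>Suc ?n. coeff p k * (dist_deriv ^^ k) T \<phi>) = (\<Sum>k\<le>?n. coeff p k * (dist_deriv ^^ k) T \<phi>)"
    by (simp add: coeff_eq_0)
  also have "(\<Sum>k\<le>Suc ?n. coeff (pCons 0 p) k * (dist_deriv ^^ k) T \<phi>)
      = (\<Sum>k\<le>?n. coeff p k * (dist_deriv ^^ k) (dist_deriv T) \<phi>)"
    by (simp add: sum.atMost_Suc_shift funpow_swap1 del: sum.atMost_Suc)
  also have "- l * (\<Sum>k\<le>?n. coeff p k * (dist_deriv ^^ k) T \<phi>)
      + (\<Sum>k\<le>?n. coeff p k * (dist_deriv ^^ k) (dist_deriv T) \<phi>)
      = (\<Sum>k\<le>?n. coeff p k * (1 * (dist_deriv ^^ k) (dist_deriv T) \<phi> + - l * (dist_deriv ^^ k) T \<phi>))"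
    by (simp add: sum_distrib_left sum.distrib[symmetric] sum_subtractf algebra_simps)
  also have "\<dots> = poly_dist_deriv p (\<lambda>\<phi>. dist_deriv T \<phi> - l * T \<phi>) \<phi>"
    unfolding poly_dist_deriv_def dist_deriv_funpow_linear[symmetric] by simp
  finally show "poly_dist_deriv ([:- l, 1:] * p) T \<phi>
      = poly_dist_deriv p (\<lambda>\<phi>. dist_deriv T \<phi> - l * T \<phi>) \<phi>" .
qed

text \<open>The map must land in \<open>Y\<close> for surjectivity to make sense. Derivatives are
  shifted to finitely many test functions that do not depend on \<xi>, and the coefficients of the
  symbol grow polynomially.\<close>

lemma symbol_operator_in_Y:
  assumes "T \<in> Y"
  shows "symbol_operator P T \<in> Y"
  unfolding Y_iff
proof (intro conjI allI)
  have T: "T \<xi> \<in> tempered_distributions" "poly_bounded (\<lambda>\<xi>. cmod (T \<xi> \<phi>))" for \<xi> \<phi>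
    using assms by (auto simp: Y_iff)
  have eq: "symbol_operator P T \<xi> =
      (\<lambda>\<phi>. \<Sum>k\<le>degree P. coeff (symbol P \<xi>) k * (dist_deriv ^^ k) (T \<xi>) \<phi>)" for \<xi>
    unfolding symbol_operator_def by (rule ext) (rule poly_dist_deriv_eq_sum[OF degree_symbol_le])
  show "symbol_operator P T \<xi> \<in> tempered_distributions" for \<xi>
    unfolding eq by (intro tempered_sum tempered_scale tempered_dist_deriv_funpow T)
  show "poly_bounded (\<lambda>\<xi>. cmod (symbol_operator P T \<xi> \<phi>))" for \<phi>
  proof (rule poly_bounded_mono)
    show "poly_bounded (\<lambda>\<xi>. \<Sum>k\<le>degree P. cmod (coeff (symbol P \<xi>) k) *
        cmod (T \<xi> ((schwartz_deriv ^^ k) \<phi>)))"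
      by (intro poly_bounded_sum poly_bounded_mult poly_bounded_coeff_symbol T norm_ge_zero)
    show "cmod (symbol_operator P T \<xi> \<phi>) \<le>
        (\<Sum>k\<le>degree P. cmod (coeff (symbol P \<xi>) k) * cmod (T \<xi> ((schwartz_deriv ^^ k) \<phi>)))" for \<xi>
      unfolding eq dist_deriv_funpow by (rule sum_norm_le) (simp add: norm_mult norm_power)
  qed
qed

lemma solve_linear_factor:
  assumes S: "S \<in> Y" and l: "poly_bounded (\<lambda>\<xi>. ode_const (l \<xi>))"
  shows "\<exists>T\<in>Y. \<forall>\<xi>. (\<lambda>\<phi>. dist_deriv (T \<xi>) \<phi> - l \<xi> * T \<xi> \<phi>) = S \<xi>"
proof -
  have temp: "S \<xi> \<in> tempered_distributions" for \<xi> using S by (simp add: Y_iff)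
  have lin: "schwartz_linear (S \<xi>)" for \<xi> using temp tempered_iff by blast
  obtain Q where "\<And>l. \<exists>B. ode_left_inverse l (\<lambda>N. Q N * ode_const l ^ (2 * N + 2)) B"
    using left_inverse_ex by blast
  then obtain B where B: "\<And>l. ode_left_inverse l (\<lambda>N. Q N * ode_const l ^ (2 * N + 2)) (B l)"
    by metis
  have "\<exists>k::nat. \<forall>\<xi>. cmod (S \<xi> \<phi>) \<le> real k * (1 + norm1 \<xi>) ^ k" for \<phi>
    using S by (simp add: Y_def)
  from uniform_tempered_bound[of S, OF temp this] obtain C k N
    where C: "\<And>\<xi> r \<phi>. wbound N r \<phi> \<Longrightarrow> cmod (S \<xi> \<phi>) \<le> C * (1 + norm1 \<xi>) ^ k * r" by blast
  define T where "T \<xi> \<phi> = - S \<xi> (B (l \<xi>) \<phi>)" for \<xi> \<phi>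
  let ?R = "\<lambda>\<xi>. Q N * ode_const (l \<xi>) ^ (2 * N + 2)"
  have T_le: "cmod (T \<xi> \<phi>) \<le> C * (1 + norm1 \<xi>) ^ k * ?R \<xi> * r" if "wbound (2 * N + 2) r \<phi>" for \<xi> r \<phi>
  proof -
    have "wbound N (?R \<xi> * r) (B (l \<xi>) \<phi>)" using B that unfolding ode_left_inverse_def by blast
    from C[OF this, of \<xi>] show ?thesis by (simp add: T_def mult.assoc)
  qed
  have "T \<xi> \<in> tempered_distributions" for \<xi>
    unfolding tempered_iff
  proof
    show "schwartz_linear (T \<xi>)"
      using B[of "l \<xi>"] lin[of \<xi>] unfolding ode_left_inverse_def schwartz_linear_def T_def by simp
  qed (use T_le in blast)
  moreover have "poly_bounded (\<lambda>\<xi>. cmod (T \<xi> \<phi>))" for \<phi>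
  proof -
    obtain r where r: "0 < r" "wbound (2 * N + 2) r \<phi>" using ex_wbound by blast
    show ?thesis
    proof (rule poly_bounded_mono)
      show "poly_bounded (\<lambda>\<xi>. (1 + norm1 \<xi>) ^ k * ode_const (l \<xi>) ^ (2 * N + 2) * \<bar>C * Q N * r\<bar>)"
        by (intro poly_bounded_mult poly_bounded_power poly_bounded_const poly_bounded_one_plus_norm1 l
            mult_nonneg_nonneg zero_le_power) (auto simp: norm1_nonneg)
      fix \<xi>
      have "C * (1 + norm1 \<xi>) ^ k * ?R \<xi> * r = (1 + norm1 \<xi>) ^ k * ode_const (l \<xi>) ^ (2 * N + 2) * (C * Q N * r)"
        by (simp only: mult_ac)
      also have "\<dots> \<le> (1 + norm1 \<xi>) ^ k * ode_const (l \<xi>) ^ (2 * N + 2) * \<bar>C * Q N * r\<bar>"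
        by (intro mult_left_mono mult_nonneg_nonneg zero_le_power) (auto simp: norm1_nonneg)
      finally show "cmod (T \<xi> \<phi>) \<le> (1 + norm1 \<xi>) ^ k * ode_const (l \<xi>) ^ (2 * N + 2) * \<bar>C * Q N * r\<bar>"
        using T_le[OF r(2)] by (rule order_trans[rotated])
    qed
  qed
  ultimately have "T \<in> Y" by (simp add: Y_iff)
  \<comment> \<open>Pairing (d/dt - l) T with \<phi> amounts to pairing T with -(d/dt + l) \<phi>;
    the minus sign in \<open>T\<close> cancels this one, and the left inverse returns
    \<phi>.\<close>
  moreover have "dist_deriv (T \<xi>) \<phi> - l \<xi> * T \<xi> \<phi> = S \<xi> \<phi>" for \<xi> \<phi>
  proof -
    have "B (l \<xi>) (schwartz_deriv \<phi>) + schwartz_scale (l \<xi>) (B (l \<xi>) \<phi>)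
        = B (l \<xi>) (schwartz_deriv \<phi> + schwartz_scale (l \<xi>) \<phi>)"
      using B[of "l \<xi>"] unfolding ode_left_inverse_def by metis
    also have "\<dots> = \<phi>" using B[of "l \<xi>"] unfolding ode_left_inverse_def by blast
    finally have "S \<xi> \<phi> = S \<xi> (B (l \<xi>) (schwartz_deriv \<phi>) + schwartz_scale (l \<xi>) (B (l \<xi>) \<phi>))" by simp
    also have "\<dots> = S \<xi> (B (l \<xi>) (schwartz_deriv \<phi>)) + l \<xi> * S \<xi> (B (l \<xi>) \<phi>)"
      using lin[of \<xi>] by (simp add: schwartz_linear_def)
    finally show ?thesis by (simp add: dist_deriv_def T_def)
  qed
  ultimately show ?thesis by blast
qed

text \<open>The induction is over a bound M common to all \<xi>, since the number of factors varies
  with \<xi>. Once at most M factors are dealt with everywhere, factor M + 1 is removed at exactly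
  those \<xi> that have it.\<close>

lemma solve_linear_factors:
  fixes n :: "int ^ 'n \<Rightarrow> nat"
  assumes b: "poly_bounded b" "\<And>\<xi>. 0 \<le> b \<xi>"
    and "\<And>\<xi>. n \<xi> \<le> M" "\<And>\<xi> j. 1 \<le> j \<Longrightarrow> j \<le> n \<xi> \<Longrightarrow> ode_const (lam \<xi> j) \<le> b \<xi>" "S \<in> Y"
  shows "\<exists>T\<in>Y. \<forall>\<xi>. poly_dist_deriv (\<Prod>j=1..n \<xi>. [:- lam \<xi> j, 1:]) (T \<xi>) = S \<xi>"
  using assms(3-)
proof (induction M arbitrary: n)
  case 0
  then show ?case by (auto simp: poly_dist_deriv_1 intro!: bexI[of _ S])
next
  case (Suc M)
  define n' where "n' \<xi> = min (n \<xi>) M" for \<xi>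
  obtain U where U: "U \<in> Y" "\<And>\<xi>. poly_dist_deriv (\<Prod>j=1..n' \<xi>. [:- lam \<xi> j, 1:]) (U \<xi>) = S \<xi>"
    using Suc.IH[of n'] Suc.prems by (auto simp: n'_def)
  \<comment> \<open>Where there is no further root, 0 is a filler with \<open>ode_const 0\<close>
    equal to 2, hence the majorant b + 2; the solution \<open>V\<close> is discarded at those
    \<xi>.\<close>
  define l where "l \<xi> = (if n \<xi> = Suc M then lam \<xi> (Suc M) else 0)" for \<xi>
  have "poly_bounded (\<lambda>\<xi>. ode_const (l \<xi>))"
  proof (rule poly_bounded_mono)
    show "poly_bounded (\<lambda>\<xi>. b \<xi> + 2)" by (intro poly_bounded_add b poly_bounded_const)
    show "ode_const (l \<xi>) \<le> b \<xi> + 2" for \<xi>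
      using Suc.prems(2)[of "Suc M" \<xi>] b(2)[of \<xi>]
      by (cases "n \<xi> = Suc M") (simp_all add: l_def ode_const_def[of 0])
  qed
  from solve_linear_factor[OF U(1) this] obtain V where V: "V \<in> Y"
    "\<And>\<xi>. (\<lambda>\<phi>. dist_deriv (V \<xi>) \<phi> - l \<xi> * V \<xi> \<phi>) = U \<xi>" by blast
  define T where "T \<xi> = (if n \<xi> = Suc M then V \<xi> else U \<xi>)" for \<xi>
  have "T \<in> Y"
    unfolding Y_iff
  proof (intro conjI allI)
    show "T \<xi> \<in> tempered_distributions" for \<xi> using U(1) V(1) by (simp add: T_def Y_iff)
    show "poly_bounded (\<lambda>\<xi>. cmod (T \<xi> \<phi>))" for \<phi>
    proof (rule poly_bounded_mono)
      show "poly_bounded (\<lambda>\<xi>. cmod (V \<xi> \<phi>) + cmod (U \<xi> \<phi>))"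
        using U(1) V(1) by (intro poly_bounded_add) (simp_all add: Y_iff)
    qed (simp add: T_def)
  qed
  moreover have "poly_dist_deriv (\<Prod>j=1..n \<xi>. [:- lam \<xi> j, 1:]) (T \<xi>) = S \<xi>" for \<xi>
  proof (cases "n \<xi> = Suc M")
    case True
    then have "(\<Prod>j=1..n \<xi>. [:- lam \<xi> j, 1:]) = [:- l \<xi>, 1:] * (\<Prod>j=1..n' \<xi>. [:- lam \<xi> j, 1:])"
      by (simp add: l_def n'_def mult.commute prod.atLeast_Suc_atMost_Suc_shift del: mult_pCons_left mult_pCons_right)
    moreover have "T \<xi> = V \<xi>" using True by (simp add: T_def)
    ultimately show ?thesis
      using V(2)[of \<xi>] U(2)[of \<xi>] by (simp only: poly_dist_deriv_linear_factor)
  next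
    case False
    then have "n' \<xi> = n \<xi>" using Suc.prems(1)[of \<xi>] by (simp add: n'_def)
    with False U(2)[of \<xi>] show ?thesis by (simp add: T_def)
  qed
  ultimately show ?case by blast
qed

section \<open>Bounds on the roots, and the conclusion\<close>

lemma root_bound:
  fixes p :: "complex poly"
  assumes "poly p z = 0" "p \<noteq> 0"
  shows "cmod z \<le> 1 + (\<Sum>k\<le>degree p. cmod (coeff p k)) * cmod (inverse (lead_coeff p))"
proof (cases "cmod z \<le> 1")
  case True
  then show ?thesis by (simp add: add_increasing2 sum_nonneg)
next
  case False
  have "degree p \<noteq> 0"
  proof
    assume "degree p = 0"
    then obtain a where "p = [:a:]" by (rule degree_eq_zeroE)
    with assms show False by simp
  qed
  then obtain n where n: "degree p = Suc n" using not0_implies_Suc by blast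
  have "0 = (\<Sum>k\<le>n. coeff p k * z ^ k) + lead_coeff p * z ^ Suc n"
    using assms(1) by (simp add: poly_altdef n)
  then have "lead_coeff p * z ^ Suc n = - (\<Sum>k\<le>n. coeff p k * z ^ k)"
    by (simp add: eq_neg_iff_add_eq_0 add.commute)
  then have "cmod (lead_coeff p) * cmod z ^ Suc n = cmod (\<Sum>k\<le>n. coeff p k * z ^ k)"
    by (metis norm_minus_cancel norm_mult norm_power)
  \<comment> \<open>As |z| > 1, every lower power is at most |z|^n, which is then cancelled. The
    summand 1 in the bound takes care of |z| \<le> 1.\<close>
  also have "\<dots> \<le> (\<Sum>k\<le>n. cmod (coeff p k) * cmod z ^ n)"
    using False by (intro sum_norm_le) (auto simp: norm_mult norm_power intro!: mult_left_mono power_increasing)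
  also have "\<dots> \<le> (\<Sum>k\<le>degree p. cmod (coeff p k)) * cmod z ^ n"
    by (simp add: n sum_distrib_right[symmetric] mult_right_mono)
  finally have "(cmod (lead_coeff p) * cmod z) * cmod z ^ n \<le> (\<Sum>k\<le>degree p. cmod (coeff p k)) * cmod z ^ n"
    by (simp add: mult_ac)
  moreover have "0 < cmod z ^ n" using False by (intro zero_less_power) linarith
  ultimately have "cmod (lead_coeff p) * cmod z \<le> (\<Sum>k\<le>degree p. cmod (coeff p k))"
    by (simp only: mult_le_cancel_right_pos)
  moreover have "0 < cmod (lead_coeff p)" using assms(2) by simp
  ultimately have "cmod z \<le> (\<Sum>k\<le>degree p. cmod (coeff p k)) * cmod (inverse (lead_coeff p))"
    unfolding norm_inverse divide_inverse[symmetric] by (simp only: pos_le_divide_eq mult.commute)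
  then show ?thesis by simp
qed

lemma root_distance_pos: "0 < root_distance m r"
proof (cases "\<forall>j\<in>{1..m}. Re (r j) = 0")
  case False
  then have "(\<lambda>j. \<bar>Re (r j)\<bar>) ` {j \<in> {1..m}. Re (r j) \<noteq> 0} \<noteq> {}" by auto
  moreover have "root_distance m r = Min ((\<lambda>j. \<bar>Re (r j)\<bar>) ` {j \<in> {1..m}. Re (r j) \<noteq> 0})"
    using False unfolding root_distance_def by (rule if_not_P)
  ultimately show ?thesis by simp
qed (simp add: root_distance_def)

lemma root_distance_le:
  assumes "1 \<le> j" "j \<le> m" "Re (r j) \<noteq> 0"
  shows "root_distance m r \<le> \<bar>Re (r j)\<bar>"
proof -
  have "root_distance m r = Min ((\<lambda>j. \<bar>Re (r j)\<bar>) ` {j \<in> {1..m}. Re (r j) \<noteq> 0})"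
    unfolding root_distance_def using assms by (intro if_not_P) auto
  also have "\<dots> \<le> \<bar>Re (r j)\<bar>" using assms by (intro Min_le) auto
  finally show ?thesis .
qed

theorem theorem1p2:
  fixes P :: "(('n::finite \<Rightarrow>\<^sub>0 nat) \<Rightarrow>\<^sub>0 complex) poly"
    and c :: "int ^ 'n \<Rightarrow> complex"
    and m :: "int ^ 'n \<Rightarrow> nat"
    and lam :: "int ^ 'n \<Rightarrow> nat \<Rightarrow> complex"
  assumes factorization:
      "\<And>\<xi>. symbol P \<xi> = smult (c \<xi>) (\<Prod>j=1..m \<xi>. [:- lam \<xi> j, 1:])"
    and c_nonzero: "\<And>\<xi>. c \<xi> \<noteq> 0"
    and c_growth: "(\<lambda>\<xi>. inverse (c \<xi>)) \<in> poly_growth"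
    and d_growth: "(\<lambda>\<xi>. inverse (complex_of_real (root_distance (m \<xi>) (lam \<xi>)))) \<in> poly_growth"
  shows "symbol_operator P ` Y = Y"
proof (intro equalityI subsetI)
  fix S assume "S \<in> symbol_operator P ` Y"
  then show "S \<in> Y" using symbol_operator_in_Y by auto
next
  fix S :: "int ^ 'n \<Rightarrow> schwartz \<Rightarrow> complex" assume S: "S \<in> Y"
  have c_bounded: "poly_bounded (\<lambda>\<xi>. cmod (inverse (c \<xi>)))"
    using c_growth by (simp only: poly_growth_iff)
  have d_bounded: "poly_bounded (\<lambda>\<xi>. inverse (root_distance (m \<xi>) (lam \<xi>)))"
    using d_growth root_distance_pos
    by (simp add: poly_growth_iff norm_inverse abs_of_pos)
  \<comment> \<open>Dividing by c at the start stays in \<open>Y\<close> by the growth condition on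
    1 / c and leaves a product of monic factors.\<close>
  define S' where "S' \<xi> \<phi> = inverse (c \<xi>) * S \<xi> \<phi>" for \<xi> \<phi>
  have S': "S' \<in> Y"
    unfolding Y_iff
  proof (intro conjI allI)
    show "S' \<xi> \<in> tempered_distributions" for \<xi>
      unfolding S'_def using S by (intro tempered_scale) (simp add: Y_iff)
    show "poly_bounded (\<lambda>\<xi>. cmod (S' \<xi> \<phi>))" for \<phi>
      unfolding S'_def norm_mult using S
      by (intro poly_bounded_mult c_bounded norm_ge_zero) (simp add: Y_iff)
  qed
  \<comment> \<open>Comparison of degree and leading coefficient: the number of roots is bounded by
    the degree of P for all \<xi> at once, and the inverse of the leading coefficient in the root
    bound is 1 / c.\<close>
  have degree_symbol: "degree (symbol P \<xi>) = m \<xi>" for \<xi>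
    unfolding factorization using c_nonzero by (simp add: degree_prod_sum_eq)
  have lead_coeff_symbol: "lead_coeff (symbol P \<xi>) = c \<xi>" for \<xi>
    unfolding factorization lead_coeff_smult lead_coeff_prod by simp
  \<comment> \<open>A majorant of \<open>ode_const\<close>: the second bracket is Cauchy's bound for
    the modulus of a root. In the first, the inverse distance bounds 1 / |Re \<lambda>|, and 2
    collects the 1 in \<open>ode_const\<close> and the 1 assigned to imaginary roots.\<close>
  define b where "b \<xi> = (2 + inverse (root_distance (m \<xi>) (lam \<xi>))) + (1 +
    (\<Sum>k\<le>degree P. cmod (coeff (symbol P \<xi>) k)) * cmod (inverse (c \<xi>)))" for \<xi>
  have "poly_bounded b"
    unfolding b_def[abs_def]
    by (intro poly_bounded_add poly_bounded_mult poly_bounded_sum poly_bounded_const d_bounded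
        poly_bounded_coeff_symbol c_bounded sum_nonneg norm_ge_zero)
  moreover have "0 \<le> b \<xi>" for \<xi>
    using root_distance_pos[of "m \<xi>" "lam \<xi>"] by (simp add: b_def sum_nonneg)
  moreover have "m \<xi> \<le> degree P" for \<xi>
    using degree_symbol_le[of P \<xi>] by (simp add: degree_symbol)
  moreover have "ode_const (lam \<xi> j) \<le> b \<xi>" if j: "1 \<le> j" "j \<le> m \<xi>" for \<xi> j
  proof -
    have "poly (symbol P \<xi>) (lam \<xi> j) = 0"
      unfolding factorization using j by (auto simp: poly_prod intro!: prod_zero bexI[of _ j])
    moreover have "symbol P \<xi> \<noteq> 0" using lead_coeff_symbol[of \<xi>] c_nonzero[of \<xi>] by auto
    ultimately have "cmod (lam \<xi> j) \<le>
        1 + (\<Sum>k\<le>degree (symbol P \<xi>). cmod (coeff (symbol P \<xi>) k)) * cmod (inverse (c \<xi>))"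
      using root_bound[of "symbol P \<xi>" "lam \<xi> j"] unfolding lead_coeff_symbol by blast
    also have "\<dots> \<le> 1 + (\<Sum>k\<le>degree P. cmod (coeff (symbol P \<xi>) k)) * cmod (inverse (c \<xi>))"
      using degree_symbol_le[of P \<xi>] by (intro add_left_mono mult_right_mono sum_mono2) auto
    finally have "cmod (lam \<xi> j) \<le> 1 + (\<Sum>k\<le>degree P. cmod (coeff (symbol P \<xi>) k)) * cmod (inverse (c \<xi>))" .
    moreover have "(if Re (lam \<xi> j) = 0 then 1 else 1 / \<bar>Re (lam \<xi> j)\<bar>)
        \<le> 1 + inverse (root_distance (m \<xi>) (lam \<xi>))"
    proof (cases "Re (lam \<xi> j) = 0")
      case True
      then show ?thesis using root_distance_pos[of "m \<xi>" "lam \<xi>"] by simp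
    next
      case False
      from le_imp_inverse_le[OF root_distance_le[of j "m \<xi>" "lam \<xi>", OF j False] root_distance_pos] False
      show ?thesis by (simp add: divide_inverse)
    qed
    ultimately show ?thesis unfolding ode_const_def b_def by linarith
  qed
  ultimately obtain T where T: "T \<in> Y"
    "\<And>\<xi>. poly_dist_deriv (\<Prod>j=1..m \<xi>. [:- lam \<xi> j, 1:]) (T \<xi>) = S' \<xi>"
    using solve_linear_factors[of b m "degree P" lam S'] S' by blast
  have "symbol_operator P T \<xi> \<phi> = S \<xi> \<phi>" for \<xi> \<phi>
    unfolding symbol_operator_def factorization poly_dist_deriv_smult T(2) S'_def
    using c_nonzero by simp
  then have "symbol_operator P T = S" by (intro ext)
  with T(1) show "S \<in> symbol_operator P ` Y" by blast
qed

end
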